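(* Let $m,p\ge1$ be integers. Let $\mathcal{M}$ be a closed subspace of $H^2_{\mathbb{C}^m}(\mathbb{D})$ which is nearly $S^*$-invariant with defect $p$, with defect space $\mathcal{F}$ (orthogonal to $\mathcal{M}$), and suppose that $\mathcal{F}$ has an orthonormal basis $\{E_1,\dots,E_p\}$ and $\mathcal{W}:=\mathcal{M}\ominus(\mathcal{M}\cap zH^2_{\mathbb{C}^m}(\mathbb{D}))$ has an orthonormal basis $\{W_1,\dots,W_r\}$ both consisting of bounded analytic functions. Let $F_0$ be the $m\times r$ matrix-valued function whose columns are $W_1,\dots,W_r$. Then: (i) If there are functions in $\mathcal{M}$ that do not vanish at $0$, then $$\mathcal{M}^\perp=\Big\{G\in H^2_{\mathbb{C}^m}(\mathbb{D}):\ T_{F_0}^*G\oplus T_{E_1}^*S^*G\oplus T_{E_2}^*S^*G\oplus\cdots\oplus T_{E_p}^*S^*G\in\mathcal{K}^\perp\Big\}$$ for some closed $S\oplus\cdots\oplus S$-invariant subspace $\mathcal{K}^\perp$ of $H^2_{\mathbb{C}^{r+p}}(\mathbb{D})=H^2_{\mathbb{C}^r}(\mathbb{D})\times H^2_{\mathbb{C}}(\mathbb{D})\times\cdots\times H^2_{\mathbb{C}}(\mathbb{D})$ ($p$ scalar factors). (ii) If all functions in $\mathcal{M}$ vanish at $0$, then $$\mathcal{M}^\perp=\Big\{G\in H^2_{\mathbb{C}^m}(\mathbb{D}):\ T_{E_1}^*S^*G\oplus T_{E_2}^*S^*G\oplus\cdots\oplus T_{E_p}^*S^*G\in\mathcal{K}^\perp\Big\}$$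 for some closed $S\oplus\cdots\oplus S$-invariant subspace $\mathcal{K}^\perp$ of $H^2_{\mathbb{C}^{p}}(\mathbb{D})$. Conversely, let $\mathcal{M}$ be a closed subspace of $H^2_{\mathbb{C}^m}(\mathbb{D})$, let $\{W_1,\dots,W_r\}$ be an orthonormal basis of $\mathcal{M}\ominus(\mathcal{M}\cap zH^2_{\mathbb{C}^m}(\mathbb{D}))$ consisting of bounded analytic functions, $F_0$ the matrix with columns $W_1,\dots,W_r$, and $\{E_1,\dots,E_p\}$ an orthonormal basis, consisting of bounded analytic functions, of a $p$-dimensional subspace $\mathcal{F}$ orthogonal to $\mathcal{M}$. If $\mathcal{M}^\perp$ has a representation as in (i) (with functions in $\mathcal{M}$ not vanishing at $0$) or as in (ii) (with all functions in $\mathcal{M}$ vanishing at $0$), then $\mathcal{M}$ is nearly $S^*$-invariant with defect $p$.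
   Context: $H^2_{\mathbb{C}^m}(\mathbb{D})$ is the Hilbert space of $\mathbb{C}^m$-valued analytic functions $F(z)=\sum_{n\ge0}A_nz^n$ on the unit disc $\mathbb{D}$ with $\|F\|^2=\sum_n\|A_n\|^2<\infty$. $S$ is the shift $(SF)(z)=zF(z)$ and $S^*$ its adjoint, the backward shift $(S^*F)(z)=(F(z)-F(0))/z$; $S\oplus\cdots\oplus S$ denotes the shift on $H^2_{\mathbb{C}^{r+p}}(\mathbb{D})$ (resp. $H^2_{\mathbb{C}^p}(\mathbb{D})$). A closed subspace $\mathcal{M}\subset H^2_{\mathbb{C}^m}(\mathbb{D})$ is nearly $S^*$-invariant with defect $p$ if there is a $p$-dimensional subspace $\mathcal{F}\subset H^2_{\mathbb{C}^m}(\mathbb{D})$, orthogonal to $\mathcal{M}$ (the defect space), such that $F\in\mathcal{M}$ and $F(0)=0$ imply $S^*F\in\mathcal{M}\oplus\mathcal{F}$. The dimension $p$ is not required to be minimal. For a bounded analytic function $\Phi$ on $\mathbb{D}$ with values in $\mathcal{L}(\mathbb{C}^k,\mathbb{C}^m)$, $T_\Phi:H^2_{\mathbb{C}^k}(\mathbb{D})\to H^2_{\mathbb{C}^m}(\mathbb{D})$ is the bounded multiplication operator $(T_\Phi G)(z)=\Phi(z)G(z)$ and $T_\Phi^*$ its Hilbert space adjoint. A $\mathbb{C}^m$-valued bounded analytic function $E_j$ is viewed as $\mathcal{L}(\mathbb{C},\mathbb{C}^m)$-valued, so $T_{E_j}:H^2_{\mathbb{C}}(\mathbb{D})\to H^2_{\mathbb{C}^m}(\mathbb{D})$.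 *)

theory Defs
  imports "HOL-Complex_Analysis.Complex_Analysis" "Jordan_Normal_Form.Matrix"
begin

unbundle no vec_syntax
unbundle no inner_syntax

text \<open>
  The dimensions of the coefficient spaces vary inside the statement, so \<open>\<complex>\<^sup>m\<close> is
  \<^term>\<open>carrier_vec m\<close>. A function on the disc is represented by its extension by zero to the
  whole plane, so that equality of functions on the disc is equality in HOL.
\<close>

type_synonym vfun = "complex \<Rightarrow> complex Matrix.vec"

definition vnorm :: "complex Matrix.vec \<Rightarrow> real" where
  "vnorm v = sqrt (Re (v \<bullet>c v))"

definition taylor_coeff :: "vfun \<Rightarrow> nat \<Rightarrow> complex Matrix.vec" where
  "taylor_coeff F n =
     Matrix.vec (dim_vec (F 0)) (\<lambda>i. (deriv ^^ n) (\<lambda>z. F z $ i) 0 / fact n)"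

definition H2 :: "nat \<Rightarrow> vfun set" where
  "H2 m = {F. (\<forall>z. F z \<in> carrier_vec m) \<and>
              (\<forall>z. z \<notin> ball 0 1 \<longrightarrow> F z = 0\<^sub>v m) \<and>
              (\<forall>i<m. (\<lambda>z. F z $ i) holomorphic_on ball 0 1) \<and>
              summable (\<lambda>n. (vnorm (taylor_coeff F n))\<^sup>2)}"

definition H2_norm :: "vfun \<Rightarrow> real" where
  "H2_norm F = sqrt (\<Sum>n. (vnorm (taylor_coeff F n))\<^sup>2)"

definition H2_inner :: "vfun \<Rightarrow> vfun \<Rightarrow> complex" where
  "H2_inner F G = (\<Sum>n. taylor_coeff F n \<bullet>c taylor_coeff G n)"

definition bounded_on_disc :: "vfun \<Rightarrow> bool" where
  "bounded_on_disc F \<longleftrightarrow> (\<exists>B. \<forall>z\<in>ball 0 1. vnorm (F z) \<le> B)"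

definition H2_subspace :: "nat \<Rightarrow> vfun set \<Rightarrow> bool" where
  "H2_subspace m M \<longleftrightarrow> M \<subseteq> H2 m \<and> (\<lambda>z. 0\<^sub>v m) \<in> M \<and>
     (\<forall>F\<in>M. \<forall>G\<in>M. (\<lambda>z. F z + G z) \<in> M) \<and>
     (\<forall>c. \<forall>F\<in>M. (\<lambda>z. c \<cdot>\<^sub>v F z) \<in> M)"

definition H2_closed_subspace :: "nat \<Rightarrow> vfun set \<Rightarrow> bool" where
  "H2_closed_subspace m M \<longleftrightarrow> H2_subspace m M \<and>
     (\<forall>X F. (\<forall>n. X n \<in> M) \<and> F \<in> H2 m \<and> (\<lambda>n. H2_norm (\<lambda>z. X n z - F z)) \<longlonglongrightarrow> 0
        \<longrightarrow> F \<in> M)"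

definition lincomb :: "nat \<Rightarrow> nat \<Rightarrow> (nat \<Rightarrow> complex) \<Rightarrow> (nat \<Rightarrow> vfun) \<Rightarrow> vfun" where
  "lincomb m n c B = (\<lambda>z. Matrix.vec m (\<lambda>i. \<Sum>j<n. c j * B j z $ i))"

definition H2_dim :: "nat \<Rightarrow> vfun set \<Rightarrow> nat \<Rightarrow> bool" where
  "H2_dim m N n \<longleftrightarrow> (\<exists>B. (\<forall>j<n. B j \<in> N) \<and>
     (\<forall>c. lincomb m n c B = (\<lambda>z. 0\<^sub>v m) \<longrightarrow> (\<forall>j<n. c j = 0)) \<and>
     (\<forall>F\<in>N. \<exists>c. F = lincomb m n c B))"

definition orthonormal_basis :: "nat \<Rightarrow> vfun set \<Rightarrow> nat \<Rightarrow> (nat \<Rightarrow> vfun) \<Rightarrow> bool" where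
  "orthonormal_basis m N n B \<longleftrightarrow> (\<forall>j<n. B j \<in> N) \<and>
     (\<forall>i<n. \<forall>j<n. H2_inner (B i) (B j) = (if i = j then 1 else 0)) \<and>
     (\<forall>F\<in>N. \<exists>c. F = lincomb m n c B)"

definition H2_ominus :: "vfun set \<Rightarrow> vfun set \<Rightarrow> vfun set" (infixl \<open>\<ominus>\<^sub>H\<close> 65) where
  "M \<ominus>\<^sub>H N = {F \<in> M. \<forall>G\<in>N. H2_inner F G = 0}"

definition H2_orthogonal :: "vfun set \<Rightarrow> vfun set \<Rightarrow> bool" where
  "H2_orthogonal M N \<longleftrightarrow> (\<forall>F\<in>M. \<forall>G\<in>N. H2_inner F G = 0)"

definition H2_plus :: "vfun set \<Rightarrow> vfun set \<Rightarrow> vfun set" (infixl \<open>\<oplus>\<^sub>H\<close> 65) where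
  "M \<oplus>\<^sub>H N = {(\<lambda>z. F z + G z) | F G. F \<in> M \<and> G \<in> N}"

text \<open>
  Hilbert space adjoint of an operator with domain \<^term>\<open>H2 k\<close>; the codomain is left implicit.
\<close>

definition adjoint_op :: "nat \<Rightarrow> (vfun \<Rightarrow> vfun) \<Rightarrow> vfun \<Rightarrow> vfun" where
  "adjoint_op k T G = (THE H. H \<in> H2 k \<and> (\<forall>K\<in>H2 k. H2_inner (T K) G = H2_inner K H))"

definition shift :: "vfun \<Rightarrow> vfun" where
  "shift F = (\<lambda>z. z \<cdot>\<^sub>v F z)"

definition bshift :: "nat \<Rightarrow> vfun \<Rightarrow> vfun" where
  "bshift m = adjoint_op m shift"

definition mult_op :: "(complex \<Rightarrow> complex Matrix.mat) \<Rightarrow> vfun \<Rightarrow> vfun" where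
  "mult_op \<Phi> G = (\<lambda>z. \<Phi> z *\<^sub>v G z)"

definition cols_fun :: "nat \<Rightarrow> nat \<Rightarrow> (nat \<Rightarrow> vfun) \<Rightarrow> complex \<Rightarrow> complex Matrix.mat" where
  "cols_fun m r W = (\<lambda>z. mat_of_cols m (map (\<lambda>j. W j z) [0..<r]))"

text \<open>
  The scalar space \<open>H\<^sup>2\<^sub>\<complex>\<close> is \<^term>\<open>H2 1\<close>, and \<^term>\<open>E j\<close> acts on it as an \<open>m \<times> 1\<close> matrix function.
  The following are \<open>T\<^sub>E\<^sub>1\<^sup>* S\<^sup>* G \<oplus> \<dots> \<oplus> T\<^sub>E\<^sub>p\<^sup>* S\<^sup>* G\<close>, an element of \<^term>\<open>H2 p\<close>, and
  \<open>T\<^sub>F\<^sub>0\<^sup>* G \<oplus> T\<^sub>E\<^sub>1\<^sup>* S\<^sup>* G \<oplus> \<dots> \<oplus> T\<^sub>E\<^sub>p\<^sup>* S\<^sup>* G\<close>, an element of \<^term>\<open>H2 (r + p)\<close>.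
\<close>

definition defect_sum :: "nat \<Rightarrow> nat \<Rightarrow> (nat \<Rightarrow> vfun) \<Rightarrow> vfun \<Rightarrow> vfun" where
  "defect_sum m p E G =
     (\<lambda>z. Matrix.vec p (\<lambda>j. adjoint_op 1 (mult_op (cols_fun m 1 (\<lambda>_. E j))) (bshift m G) z $ 0))"

definition full_sum ::
  "nat \<Rightarrow> nat \<Rightarrow> nat \<Rightarrow> (nat \<Rightarrow> vfun) \<Rightarrow> (nat \<Rightarrow> vfun) \<Rightarrow> vfun \<Rightarrow> vfun" where
  "full_sum m r p W E G =
     (\<lambda>z. adjoint_op r (mult_op (cols_fun m r W)) G z @\<^sub>v defect_sum m p E G z)"

definition defect_space :: "nat \<Rightarrow> nat \<Rightarrow> vfun set \<Rightarrow> vfun set \<Rightarrow> bool" where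
  "defect_space m p M N \<longleftrightarrow> H2_subspace m N \<and> H2_dim m N p \<and> H2_orthogonal N M \<and>
     (\<forall>F\<in>M. F 0 = 0\<^sub>v m \<longrightarrow> bshift m F \<in> M \<oplus>\<^sub>H N)"

definition nearly_bshift_invariant :: "nat \<Rightarrow> nat \<Rightarrow> vfun set \<Rightarrow> bool" where
  "nearly_bshift_invariant m p M \<longleftrightarrow> H2_closed_subspace m M \<and> (\<exists>N. defect_space m p M N)"

definition shift_invariant_subspace :: "nat \<Rightarrow> vfun set \<Rightarrow> bool" where
  "shift_invariant_subspace n K \<longleftrightarrow> H2_closed_subspace n K \<and> shift ` K \<subseteq> K"

end

theory Submission
  imports Defs
begin

text \<open>
  Iterating \<open>F = F\<^sub>0 a + z (F\<^sub>1 + \<Sum>\<^sub>j b\<^sub>j E\<^sub>j)\<close>, where \<open>F\<^sub>0 a\<close> is the projection of \<open>F \<in> M\<close> onto the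
  span of the \<open>W\<^sub>j\<close> and \<open>F\<^sub>1 \<in> M\<close>, gives \<open>F = F\<^sub>0 k\<^sub>0 + z \<Sum>\<^sub>j k\<^sub>j E\<^sub>j\<close> with \<open>\<parallel>k\<parallel> \<le> \<parallel>F\<parallel>\<close>,
  because the three summands are orthogonal. Writing this as \<open>F = T k\<close>, the space \<open>M\<close> is the image
  of the backward shift invariant set of all \<open>k\<close> whose backward shifts are all mapped into \<open>M\<close>
  by \<open>T\<close>. The orthogonal complement of this set is shift invariant, and \<open>T\<^sup>*\<close> is the operator in
  the statement. Conversely, if \<open>M\<^sup>\<bottom> = {G. T\<^sup>* G \<in> K}\<close>, then \<open>T\<close> maps \<open>K\<^sup>\<bottom>\<close> to a dense subspace of \<open>M\<close>,
  and on this subspace near invariance is read off from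
  \<open>T k = F\<^sub>0 k\<^sub>0(0) + z (T (S\<^sup>* k) + \<Sum>\<^sub>j k\<^sub>j(0) E\<^sub>j)\<close>; density is used in its dual form.
\<close>

section \<open>The Hilbert space of square-summable families\<close>

text \<open>The dimensions vary, so all functions become families in one type, indexed by component
  and Taylor index, and each Hardy space is a closed subspace of it. Boundedness of the
  \<open>W j\<close> and \<open>E j\<close> makes multiplication by them bounded on H^2, so the
  adjoints exist by the Riesz theorem. No formula for them is used, only the relation between the
  two inner products. The family k attached to F depends on choices and need not be linear in F.
  This is why all admissible k are collected: the invariant space is the orthogonal complement of
  that set, hence closed and linear without further work. In the converse the range of T on the
  complement of K is only known to be dense in M, so a function in M that vanishes at 0 cannot
  simply be written as T k. Membership is therefore tested against orthogonal vectors, and near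
  invariance turns into a statement about g orthogonal to M: remove from g its components along the
  \<open>E j\<close>, multiply by z, remove the components along the \<open>W j\<close>; the result
  is again orthogonal to M. If all functions in M vanish at 0, then r = 0, so that case needs no
  separate construction.\<close>

typedef 'a ell2 = "{f :: 'a \<Rightarrow> complex. (\<lambda>a. (cmod (f a))\<^sup>2) summable_on UNIV}"
  morphisms cf Abs_ell2
  by (rule exI[of _ "\<lambda>_. 0"]) simp

setup_lifting type_definition_ell2

lemma ell2_eqI: "(\<And>a. cf x a = cf y a) \<Longrightarrow> x = y"
  by (simp add: cf_inject[symmetric] fun_eq_iff)

lemma cf_summable: "(\<lambda>a. (cmod (cf x a))\<^sup>2) summable_on UNIV"
  using cf[of x] by simp

lemma square_summable_comparison:
  fixes f :: "'a \<Rightarrow> complex"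
  assumes "g summable_on UNIV" and "\<And>a. (cmod (f a))\<^sup>2 \<le> g a"
  shows "(\<lambda>a. (cmod (f a))\<^sup>2) summable_on UNIV"
  by (rule summable_on_comparison_test[OF assms(1)]) (use assms(2) in auto)

lemma square_summable_add:
  fixes f g :: "'a \<Rightarrow> complex"
  assumes "(\<lambda>a. (cmod (f a))\<^sup>2) summable_on UNIV" "(\<lambda>a. (cmod (g a))\<^sup>2) summable_on UNIV"
  shows "(\<lambda>a. (cmod (f a + g a))\<^sup>2) summable_on UNIV"
proof (rule square_summable_comparison)
  show "(\<lambda>a. 2 * (cmod (f a))\<^sup>2 + 2 * (cmod (g a))\<^sup>2) summable_on UNIV"
    by (intro summable_on_add summable_on_cmult_right assms)
  fix a
  have "(cmod (f a + g a))\<^sup>2 \<le> (cmod (f a) + cmod (g a))\<^sup>2"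
    by (intro power_mono norm_triangle_ineq) auto
  also have "\<dots> \<le> 2 * (cmod (f a))\<^sup>2 + 2 * (cmod (g a))\<^sup>2"
    using sum_squares_bound[of "cmod (f a)" "cmod (g a)"] by (simp add: power2_sum)
  finally show "(cmod (f a + g a))\<^sup>2 \<le> 2 * (cmod (f a))\<^sup>2 + 2 * (cmod (g a))\<^sup>2" .
qed

lemma square_summable_cmult:
  fixes f :: "'a \<Rightarrow> complex"
  assumes "(\<lambda>a. (cmod (f a))\<^sup>2) summable_on UNIV"
  shows "(\<lambda>a. (cmod (c * f a))\<^sup>2) summable_on UNIV"
  by (simp add: norm_mult power_mult_distrib summable_on_cmult_right assms)

lemma square_summable_mult_cnj:
  fixes f g :: "'a \<Rightarrow> complex"
  assumes "(\<lambda>a. (cmod (f a))\<^sup>2) summable_on UNIV" "(\<lambda>a. (cmod (g a))\<^sup>2) summable_on UNIV"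
  shows "(\<lambda>a. f a * cnj (g a)) summable_on UNIV"
proof (rule abs_summable_summable, rule summable_on_comparison_test)
  show "(\<lambda>a. (cmod (f a))\<^sup>2 + (cmod (g a))\<^sup>2) summable_on UNIV"
    by (intro summable_on_add assms)
  fix a
  have "cmod (f a) * cmod (g a) \<le> (cmod (f a))\<^sup>2 + (cmod (g a))\<^sup>2"
    using sum_squares_bound[of "cmod (f a)" "cmod (g a)"]
      mult_nonneg_nonneg[OF norm_ge_zero norm_ge_zero, of "f a" "g a"] by linarith
  then show "norm (f a * cnj (g a)) \<le> (cmod (f a))\<^sup>2 + (cmod (g a))\<^sup>2"
    by (simp add: norm_mult)
qed auto

definition cinner :: "'a ell2 \<Rightarrow> 'a ell2 \<Rightarrow> complex" where
  "cinner x y = (\<Sum>\<^sub>\<infinity>a. cf x a * cnj (cf y a))"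

lift_definition scaleC :: "complex \<Rightarrow> 'a ell2 \<Rightarrow> 'a ell2" (infixr \<open>*\<^sub>C\<close> 75)
  is "\<lambda>c f a. c * f a" by (rule square_summable_cmult)

lemma cinner_summable: "(\<lambda>a. cf x a * cnj (cf y a)) summable_on UNIV"
  using square_summable_mult_cnj[OF cf_summable[of x] cf_summable[of y]] .

text \<open>Only the real part of \<open>cinner\<close> fits this class, but it carries the norm and
  the topology. The complex product is recovered from it by testing with
  \<open>\<i> *\<^sub>C y\<close>.\<close>

instantiation ell2 :: (type) real_inner
begin

lift_definition zero_ell2 :: "'a ell2" is "\<lambda>_. 0" by simp
lift_definition plus_ell2 :: "'a ell2 \<Rightarrow> 'a ell2 \<Rightarrow> 'a ell2" is "\<lambda>f g a. f a + g a"
  by (rule square_summable_add)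
lift_definition uminus_ell2 :: "'a ell2 \<Rightarrow> 'a ell2" is "\<lambda>f a. - f a" by simp
definition "(x::'a ell2) - y = x + - y"
definition "scaleR r (x::'a ell2) = complex_of_real r *\<^sub>C x"
definition "inner (x::'a ell2) y = Re (cinner x y)"
definition "norm (x::'a ell2) = sqrt (inner x x)"
definition "dist (x::'a ell2) y = norm (x - y)"
definition "sgn (x::'a ell2) = complex_of_real (inverse (norm x)) *\<^sub>C x"
definition "(uniformity :: ('a ell2 \<times> 'a ell2) filter) = (INF e\<in>{0<..}. principal {(x, y). dist x y < e})"
definition "open (U::'a ell2 set) \<longleftrightarrow> (\<forall>x\<in>U. \<forall>\<^sub>F (x', y) in uniformity. x' = x \<longrightarrow> y \<in> U)"

lemmas ell2_rep_eqs = zero_ell2.rep_eq plus_ell2.rep_eq uminus_ell2.rep_eq scaleC.rep_eq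

lemma cinner_add_left: "cinner (x + y) z = cinner x z + cinner y z"
  unfolding cinner_def by (simp add: ell2_rep_eqs ring_distribs infsum_add cinner_summable)

lemma cinner_scaleC_left: "cinner (c *\<^sub>C x) y = c * cinner x y"
  unfolding cinner_def by (simp add: ell2_rep_eqs mult.assoc infsum_cmult_right')

lemma cinner_commute: "cinner x y = cnj (cinner y x)"
  unfolding cinner_def infsum_cnj[symmetric] by (simp add: mult.commute)

lemma cinner_self_infsum: "cinner x x = of_real (\<Sum>\<^sub>\<infinity>a. (cmod (cf x a))\<^sup>2)"
  unfolding cinner_def complex_norm_square[symmetric] using cf_summable
  by (intro infsumI has_sum_of_real has_sum_infsum)

instance
proof
  fix x y z :: "'a ell2" and r s :: real
  show "x + y + z = x + (y + z)" "x + y = y + x" "0 + x = x" "- x + x = 0"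
    by (rule ell2_eqI; simp add: ell2_rep_eqs)+
  show "x - y = x + - y" by (simp add: minus_ell2_def)
  show "r *\<^sub>R (x + y) = r *\<^sub>R x + r *\<^sub>R y" "(r + s) *\<^sub>R x = r *\<^sub>R x + s *\<^sub>R x"
       "r *\<^sub>R s *\<^sub>R x = (r * s) *\<^sub>R x" "1 *\<^sub>R x = x"
    by (rule ell2_eqI; simp add: scaleR_ell2_def ell2_rep_eqs ring_distribs mult.assoc)+
  show "dist x y = norm (x - y)" by (rule dist_ell2_def)
  show "sgn x = inverse (norm x) *\<^sub>R x" by (simp add: sgn_ell2_def scaleR_ell2_def)
  show "(uniformity :: ('a ell2 \<times> 'a ell2) filter) = (INF e\<in>{0<..}. principal {(x, y). dist x y < e})"
    by (rule uniformity_ell2_def)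
  show "open U = (\<forall>x\<in>U. \<forall>\<^sub>F (x', y) in uniformity. x' = x \<longrightarrow> y \<in> U)" for U :: "'a ell2 set"
    by (rule open_ell2_def)
  show "inner x y = inner y x"
    unfolding inner_ell2_def by (subst cinner_commute) simp
  show "inner (x + y) z = inner x z + inner y z"
    by (simp add: inner_ell2_def cinner_add_left)
  show "inner (r *\<^sub>R x) y = r * inner x y"
    by (simp add: inner_ell2_def scaleR_ell2_def cinner_scaleC_left)
  show "0 \<le> inner x x"
    by (simp add: inner_ell2_def cinner_self_infsum infsum_nonneg)
  show "(inner x x = 0) = (x = 0)"
  proof
    assume "inner x x = 0"
    then have "(\<Sum>\<^sub>\<infinity>a. (cmod (cf x a))\<^sup>2) = 0" by (simp add: inner_ell2_def cinner_self_infsum)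
    then have "(cmod (cf x a))\<^sup>2 = 0" for a
      using nonneg_infsum_le_0D[of "\<lambda>a. (cmod (cf x a))\<^sup>2" UNIV a] cf_summable[of x] by simp
    then show "x = 0" by (intro ell2_eqI) (simp add: ell2_rep_eqs)
  qed (simp add: inner_ell2_def cinner_self_infsum ell2_rep_eqs)
  show "norm x = sqrt (inner x x)" by (rule norm_ell2_def)
qed

end

lemma cf_0 [simp]: "cf 0 a = 0" by (simp add: ell2_rep_eqs)
lemma cf_add [simp]: "cf (x + y) a = cf x a + cf y a" by (simp add: ell2_rep_eqs)
lemma cf_uminus [simp]: "cf (- x) a = - cf x a" by (simp add: ell2_rep_eqs)
lemma cf_diff [simp]: "cf (x - y) a = cf x a - cf y a"
  unfolding minus_ell2_def cf_add cf_uminus by simp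
lemma cf_scaleC [simp]: "cf (c *\<^sub>C x) a = c * cf x a" by (simp add: ell2_rep_eqs)
lemma cf_sum [simp]: "cf (sum f A) a = (\<Sum>i\<in>A. cf (f i) a)"
  by (induction A rule: infinite_finite_induct) auto

lemma scaleR_ell2_scaleC: "r *\<^sub>R (x::'a ell2) = of_real r *\<^sub>C x"
  by (rule scaleR_ell2_def)

lemma inner_eq_Re_cinner: "inner x y = Re (cinner x y)" for x y :: "'a ell2"
  by (rule inner_ell2_def)

declare cinner_scaleC_left [simp]

lemma cinner_add_right: "cinner x (y + z) = cinner x y + cinner x z"
  unfolding cinner_commute[of x] by (simp add: cinner_add_left)
lemma cinner_scaleC_right [simp]: "cinner x (c *\<^sub>C y) = cnj c * cinner x y"
  unfolding cinner_commute[of x] by simp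
lemma cinner_0_left [simp]: "cinner 0 x = 0" by (simp add: cinner_def)
lemma cinner_0_right [simp]: "cinner x 0 = 0" by (simp add: cinner_def)
lemma cinner_diff_left: "cinner (x - y) z = cinner x z - cinner y z"
  using cinner_add_left[of "x - y" y z] by simp
lemma cinner_diff_right: "cinner x (y - z) = cinner x y - cinner x z"
  using cinner_add_right[of x "y - z" z] by simp
lemma cinner_sum_left: "cinner (sum f A) x = (\<Sum>i\<in>A. cinner (f i) x)"
  by (induction A rule: infinite_finite_induct) (auto simp: cinner_add_left)
lemma cinner_sum_right: "cinner x (sum f A) = (\<Sum>i\<in>A. cinner x (f i))"
  by (induction A rule: infinite_finite_induct) (auto simp: cinner_add_right)

lemma cinner_eq_0_commute: "cinner x y = 0 \<longleftrightarrow> cinner y x = 0"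
  by (subst cinner_commute) simp

lemma power2_norm_ell2: "(norm x)\<^sup>2 = (\<Sum>\<^sub>\<infinity>a. (cmod (cf x a))\<^sup>2)"
  by (simp add: power2_norm_eq_inner inner_eq_Re_cinner cinner_self_infsum)

lemma cinner_self: "cinner x x = of_real ((norm x)\<^sup>2)"
  by (simp only: power2_norm_ell2 cinner_self_infsum)

lemma cinner_self_eq_0 [simp]: "cinner x x = 0 \<longleftrightarrow> x = 0"
  by (simp add: cinner_self)

lemma cinner_ext:
  assumes "\<And>y. cinner y x = 0" shows "x = 0"
  using assms[of x] by simp

lemma norm_scaleC [simp]: "norm (c *\<^sub>C x) = cmod c * norm x"
  by (rule power2_eq_imp_eq)
     (simp_all add: power2_norm_ell2 norm_mult power_mult_distrib infsum_cmult_right')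

text \<open>The real Cauchy-Schwarz inequality bounds only the real part; a unimodular factor
  \<open>u\<close> on \<open>x\<close> first makes the product real and nonnegative.\<close>

lemma cmod_cinner_le: "cmod (cinner x y) \<le> norm x * norm y"
proof (cases "cinner x y = 0")
  case False
  define u where "u = cnj (cinner x y) / of_real (cmod (cinner x y))"
  have u: "cmod u = 1" using False by (simp add: u_def norm_divide)
  have "u * cinner x y = of_real (cmod (cinner x y))"
    using False complex_norm_square[of "cinner x y"]
    by (simp add: u_def field_simps power2_eq_square)
  then have "cmod (cinner x y) = inner (u *\<^sub>C x) y"
    by (simp add: inner_eq_Re_cinner)
  also have "\<dots> \<le> norm (u *\<^sub>C x) * norm y" by (rule norm_cauchy_schwarz)
  finally show ?thesis by (simp add: u)
qed auto

lemma sum_cf_le_norm: "finite A \<Longrightarrow> (\<Sum>a\<in>A. (cmod (cf x a))\<^sup>2) \<le> (norm x)\<^sup>2"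
  unfolding power2_norm_ell2 by (rule finite_sum_le_infsum) (auto simp: cf_summable)

lemma cmod_cf_le_norm: "cmod (cf x a) \<le> norm x"
  using sum_cf_le_norm[of "{a}" x] by (simp add: power2_le_iff_abs_le)

lemma norm_le_if_sum_cf_le:
  assumes "\<And>A. finite A \<Longrightarrow> (\<Sum>a\<in>A. (cmod (cf x a))\<^sup>2) \<le> B\<^sup>2" "0 \<le> B"
  shows "norm x \<le> B"
proof (rule power2_le_imp_le)
  show "(norm x)\<^sup>2 \<le> B\<^sup>2" unfolding power2_norm_ell2
    by (rule infsum_le_finite_sums) (auto simp: cf_summable assms)
qed fact

lemma square_summable_if_bounded:
  fixes f :: "'a \<Rightarrow> complex"
  assumes "\<And>A. finite A \<Longrightarrow> (\<Sum>a\<in>A. (cmod (f a))\<^sup>2) \<le> B"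
  shows "(\<lambda>a. (cmod (f a))\<^sup>2) summable_on UNIV"
  by (rule nonneg_bounded_partial_sums_imp_summable_on[where C = B])
     (auto simp: assms eventually_finite_subsets_at_top)

instance ell2 :: (type) complete_space
proof
  fix X :: "nat \<Rightarrow> 'a ell2"
  assume X: "Cauchy X"
  have "Cauchy (\<lambda>n. cf (X n) a)" for a
  proof (rule metric_CauchyI)
    fix e :: real assume "e > 0"
    then obtain M where M: "\<And>m n. m \<ge> M \<Longrightarrow> n \<ge> M \<Longrightarrow> dist (X m) (X n) < e"
      using metric_CauchyD[OF X] by blast
    have "dist (cf (X m) a) (cf (X n) a) < e" if "m \<ge> M" "n \<ge> M" for m n
      using cmod_cf_le_norm[of "X m - X n" a] M[OF that] by (simp add: dist_norm)
    then show "\<exists>M. \<forall>m\<ge>M. \<forall>n\<ge>M. dist (cf (X m) a) (cf (X n) a) < e" by blast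
  qed
  then have "\<exists>l. (\<lambda>n. cf (X n) a) \<longlonglongrightarrow> l" for a
    using Cauchy_convergent by (auto simp: convergent_def)
  then obtain l where l: "\<And>a. (\<lambda>n. cf (X n) a) \<longlonglongrightarrow> l a" by metis
  \<comment> \<open>The bound is uniform over finite sets, so it serves twice: for square
    summability of the coordinatewise limit \<open>l\<close>, and for convergence in norm.\<close>
  have bound: "\<exists>M. \<forall>m\<ge>M. \<forall>A. finite A \<longrightarrow> (\<Sum>a\<in>A. (cmod (cf (X m) a - l a))\<^sup>2) \<le> e\<^sup>2"
    if e: "e > 0" for e
  proof -
    obtain M where M: "\<And>m n. m \<ge> M \<Longrightarrow> n \<ge> M \<Longrightarrow> dist (X m) (X n) < e"
      using metric_CauchyD[OF X e] by blast
    have "(\<Sum>a\<in>A. (cmod (cf (X m) a - l a))\<^sup>2) \<le> e\<^sup>2" if "m \<ge> M" "finite A" for m A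
    proof (rule LIMSEQ_le_const2)
      show "(\<lambda>n. \<Sum>a\<in>A. (cmod (cf (X m) a - cf (X n) a))\<^sup>2) \<longlonglongrightarrow> (\<Sum>a\<in>A. (cmod (cf (X m) a - l a))\<^sup>2)"
        by (intro tendsto_intros l)
      have "(\<Sum>a\<in>A. (cmod (cf (X m) a - cf (X n) a))\<^sup>2) \<le> e\<^sup>2" if "n \<ge> M" for n
      proof -
        have "(\<Sum>a\<in>A. (cmod (cf (X m) a - cf (X n) a))\<^sup>2) \<le> (norm (X m - X n))\<^sup>2"
          using sum_cf_le_norm[OF \<open>finite A\<close>, of "X m - X n"] by simp
        also have "\<dots> \<le> e\<^sup>2"
          using M[OF \<open>m \<ge> M\<close> that] by (intro power_mono) (auto simp: dist_norm)
        finally show ?thesis .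
      qed
      then show "\<exists>N. \<forall>n\<ge>N. (\<Sum>a\<in>A. (cmod (cf (X m) a - cf (X n) a))\<^sup>2) \<le> e\<^sup>2" by blast
    qed
    then show ?thesis by blast
  qed
  obtain M where M: "\<And>A. finite A \<Longrightarrow> (\<Sum>a\<in>A. (cmod (cf (X M) a - l a))\<^sup>2) \<le> 1\<^sup>2"
    using bound[of 1] by auto
  have "(\<lambda>a. (cmod (cf (X M) a - l a))\<^sup>2) summable_on UNIV"
    by (rule square_summable_if_bounded) (rule M)
  \<comment> \<open>The limit is the difference of \<open>X M\<close> and \<open>X M - l\<close>,
    both square summable.\<close>
  then have "(\<lambda>a. (cmod (cf (X M) a + (- 1) * (cf (X M) a - l a)))\<^sup>2) summable_on UNIV"
    by (intro square_summable_add square_summable_cmult cf_summable)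
  then have "(\<lambda>a. (cmod (l a))\<^sup>2) summable_on UNIV" by simp
  then have cfL: "cf (Abs_ell2 l) = l" by (simp add: Abs_ell2_inverse)
  have "X \<longlonglongrightarrow> Abs_ell2 l"
  proof (rule metric_LIMSEQ_I)
    fix e :: real assume "e > 0"
    then obtain M where M: "\<And>m A. m \<ge> M \<Longrightarrow> finite A \<Longrightarrow> (\<Sum>a\<in>A. (cmod (cf (X m) a - l a))\<^sup>2) \<le> (e/2)\<^sup>2"
      using bound[of "e/2"] by auto
    have "dist (X m) (Abs_ell2 l) < e" if "m \<ge> M" for m
    proof -
      have "norm (X m - Abs_ell2 l) \<le> e/2"
        using M[OF that] \<open>e > 0\<close> by (intro norm_le_if_sum_cf_le) (auto simp: cfL)
      then show ?thesis using \<open>e > 0\<close> by (simp add: dist_norm)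
    qed
    then show "\<exists>no. \<forall>n\<ge>no. dist (X n) (Abs_ell2 l) < e" by blast
  qed
  then show "convergent X" unfolding convergent_def by blast
qed

section \<open>Projections and the Riesz representation theorem\<close>

lemma parallelogram_identity:
  fixes a b :: "'a::real_inner"
  shows "(norm (a - b))\<^sup>2 = 2 * (norm b)\<^sup>2 + 2 * (norm a)\<^sup>2 - 4 * (norm ((1/2) *\<^sub>R (a + b)))\<^sup>2"
  unfolding power2_norm_eq_inner
  by (simp add: inner_diff_left inner_diff_right inner_add_left inner_add_right inner_commute[of b a]
      field_simps)

text \<open>Midpoints of a minimizing sequence stay in \<open>S\<close>, so the parallelogram
  identity makes the sequence Cauchy; its limit is the nearest point, and minimality along every
  line through it gives orthogonality.\<close>

lemma closed_subspace_projection: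
  fixes S :: "'a::{real_inner, complete_space} set"
  assumes "closed S" "subspace S"
  obtains y where "y \<in> S" "\<And>s. s \<in> S \<Longrightarrow> inner (x - y) s = 0"
proof -
  define D where "D = (INF y\<in>S. (norm (x - y))\<^sup>2)"
  have ne: "S \<noteq> {}" using subspace_0[OF assms(2)] by auto
  have bdd: "bdd_below ((\<lambda>y. (norm (x - y))\<^sup>2) ` S)"
    by (rule bdd_belowI[of _ 0]) auto
  have D_le: "D \<le> (norm (x - y))\<^sup>2" if "y \<in> S" for y
    unfolding D_def by (rule cINF_lower[OF bdd that])
  have "\<exists>y\<in>S. (norm (x - y))\<^sup>2 < D + inverse (real (Suc n))" for n
  proof -
    have "(INF y\<in>S. (norm (x - y))\<^sup>2) < D + inverse (real (Suc n))"
      unfolding D_def[symmetric] by simp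
    then show ?thesis using cINF_less_iff[OF ne bdd] by simp
  qed
  then obtain Y where Y: "\<And>n. Y n \<in> S" "\<And>n. (norm (x - Y n))\<^sup>2 < D + inverse (real (Suc n))"
    by metis
  have near: "(norm (Y m - Y n))\<^sup>2 \<le> 4 * inverse (real (Suc N))" if "m \<ge> N" "n \<ge> N" for m n N
  proof -
    have mid: "(1/2) *\<^sub>R (Y m + Y n) \<in> S"
      by (intro subspace_scale subspace_add assms Y)
    have "(norm (Y m - Y n))\<^sup>2 =
        2 * (norm (x - Y m))\<^sup>2 + 2 * (norm (x - Y n))\<^sup>2 - 4 * (norm (x - (1/2) *\<^sub>R (Y m + Y n)))\<^sup>2"
    proof -
      have mid_eq: "x - (1/2) *\<^sub>R (Y m + Y n) = (1/2) *\<^sub>R ((x - Y n) + (x - Y m))"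
        by (simp add: algebra_simps flip: scaleR_add_left)
      have diff_eq: "Y m - Y n = (x - Y n) - (x - Y m)" by simp
      show ?thesis unfolding mid_eq diff_eq by (rule parallelogram_identity)
    qed
    moreover have "inverse (real (Suc m)) \<le> inverse (real (Suc N))"
      "inverse (real (Suc n)) \<le> inverse (real (Suc N))"
      using that by (auto intro!: le_imp_inverse_le)
    ultimately show ?thesis using Y(2)[of m] Y(2)[of n] D_le[OF mid] by linarith
  qed
  have "Cauchy Y"
  proof (rule metric_CauchyI)
    fix e :: real assume "e > 0"
    then obtain N where N: "inverse (real (Suc N)) < e\<^sup>2 / 4"
      using reals_Archimedean[of "e\<^sup>2 / 4"] by auto
    have "dist (Y m) (Y n) < e" if "m \<ge> N" "n \<ge> N" for m n
    proof (rule power2_less_imp_less)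
      show "(dist (Y m) (Y n))\<^sup>2 < e\<^sup>2"
        using near[OF that] N by (simp add: dist_norm)
    qed (use \<open>e > 0\<close> in simp)
    then show "\<exists>M. \<forall>m\<ge>M. \<forall>n\<ge>M. dist (Y m) (Y n) < e" by blast
  qed
  then obtain y where y: "Y \<longlonglongrightarrow> y"
    using Cauchy_convergent[of Y] unfolding convergent_def by blast
  have yS: "y \<in> S"
    using closed_sequentially[OF assms(1) _ y] Y(1) by blast
  have "(norm (x - y))\<^sup>2 \<le> D + 0"
  proof (rule LIMSEQ_le)
    show "(\<lambda>n. (norm (x - Y n))\<^sup>2) \<longlonglongrightarrow> (norm (x - y))\<^sup>2"
      by (intro tendsto_intros y)
    show "(\<lambda>n. D + inverse (real (Suc n))) \<longlonglongrightarrow> D + 0"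
      by (intro tendsto_add tendsto_const LIMSEQ_inverse_real_of_nat)
    show "\<exists>N. \<forall>n\<ge>N. (norm (x - Y n))\<^sup>2 \<le> D + inverse (real (Suc n))"
      using Y(2) less_imp_le by blast
  qed
  then have yD: "(norm (x - y))\<^sup>2 \<le> D" by simp
  have "inner (x - y) s = 0" if s: "s \<in> S" for s
  proof (cases "s = 0")
    case False
    \<comment> \<open>This value minimizes the quadratic function of \<open>t\<close> given by the
      squared norm of \<open>x - y - t *\<^sub>R s\<close>.\<close>
    define t where "t = inner (x - y) s / inner s s"
    have "inner s s > 0" using False by simp
    have "y + t *\<^sub>R s \<in> S" by (intro subspace_add subspace_scale assms yS s)
    then have "inner (x - y) (x - y) \<le> inner (x - y - t *\<^sub>R s) (x - y - t *\<^sub>R s)"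
      using order_trans[OF yD D_le] by (simp add: power2_norm_eq_inner diff_diff_eq)
    also have "\<dots> = inner (x - y) (x - y) - 2 * t * inner (x - y) s + t * t * inner s s"
      by (simp only: inner_diff_left[of "x - y" "t *\<^sub>R s"] inner_diff_right[of _ "x - y" "t *\<^sub>R s"]
          inner_scaleR_left inner_scaleR_right inner_commute[of s "x - y"]) (simp add: algebra_simps)
    also have "t * t * inner s s = t * inner (x - y) s"
      using \<open>inner s s > 0\<close> by (simp add: t_def)
    finally have "t * inner (x - y) s \<le> 0" by simp
    then have "(inner (x - y) s)\<^sup>2 \<le> 0"
      using \<open>inner s s > 0\<close> by (simp add: t_def power2_eq_square divide_le_0_iff)
    then show ?thesis by simp
  qed simp
  then show thesis using that yS by blast
qed

text \<open>The kernel is closed of codimension one, so a vector \<open>u\<close> normal to it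
  determines \<open>f\<close>; the factor \<open>f u / inner u u\<close> normalizes it.\<close>

lemma Riesz_representation:
  fixes f :: "'a::{real_inner, complete_space} \<Rightarrow> real"
  assumes "bounded_linear f"
  obtains y where "\<And>x. f x = inner x y"
proof (cases "\<forall>x. f x = 0")
  case True
  then show ?thesis using that[of 0] by simp
next
  case False
  then obtain z where z: "f z \<noteq> 0" by blast
  interpret bounded_linear f by fact
  have "closed (f -` {0})"
    by (intro closed_vimage closed_singleton linear_continuous_on assms)
  moreover have "subspace (f -` {0})"
    by (auto simp: subspace_def add scaleR)
  ultimately obtain p where p: "p \<in> f -` {0}" "\<And>s. s \<in> f -` {0} \<Longrightarrow> inner (z - p) s = 0"
    using closed_subspace_projection by blast
  define u where "u = z - p"
  have fu: "f u \<noteq> 0" using p(1) z by (simp add: u_def diff)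
  then have "u \<noteq> 0" by auto
  have "f x = inner x ((f u / inner u u) *\<^sub>R u)" for x
  proof -
    have "inner u (x - (f x / f u) *\<^sub>R u) = 0"
      unfolding u_def by (rule p(2)) (use fu in \<open>simp add: diff scaleR u_def[symmetric]\<close>)
    then have "inner x u = (f x / f u) * inner u u"
      by (simp add: inner_diff_right inner_commute[of x u])
    then show ?thesis using fu \<open>u \<noteq> 0\<close> by simp
  qed
  then show ?thesis using that by blast
qed

section \<open>Complex subspaces and their orthogonal complements\<close>

definition csubspace :: "'a ell2 set \<Rightarrow> bool" where
  "csubspace S \<longleftrightarrow> 0 \<in> S \<and> (\<forall>x\<in>S. \<forall>y\<in>S. x + y \<in> S) \<and> (\<forall>c. \<forall>x\<in>S. c *\<^sub>C x \<in> S)"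

lemma csubspaceD:
  assumes "csubspace S"
  shows "0 \<in> S" "x \<in> S \<Longrightarrow> y \<in> S \<Longrightarrow> x + y \<in> S" "x \<in> S \<Longrightarrow> c *\<^sub>C x \<in> S"
    "x \<in> S \<Longrightarrow> y \<in> S \<Longrightarrow> x - y \<in> S"
proof -
  have "x - y = x + (- 1) *\<^sub>C y" by (rule ell2_eqI) simp
  then show "x \<in> S \<Longrightarrow> y \<in> S \<Longrightarrow> x - y \<in> S"
    unfolding \<open>x - y = _\<close> using assms unfolding csubspace_def by blast
qed (use assms in \<open>auto simp: csubspace_def\<close>)

lemma csubspace_sum: "csubspace S \<Longrightarrow> (\<And>i. i \<in> A \<Longrightarrow> f i \<in> S) \<Longrightarrow> sum f A \<in> S"
  by (induction A rule: infinite_finite_induct) (auto simp: csubspaceD)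

lemma csubspace_imp_subspace: "csubspace S \<Longrightarrow> subspace S"
  by (simp add: subspace_def csubspaceD scaleR_ell2_scaleC)

lemma csubspace_Int: "csubspace S \<Longrightarrow> csubspace T \<Longrightarrow> csubspace (S \<inter> T)"
  by (auto simp: csubspace_def)

text \<open>The bridge from real to complex orthogonality: a complex subspace contains i s along
  with s.\<close>

lemma Im_cinner: "Im (cinner x y) = Re (cinner x (\<i> *\<^sub>C y))"
  by simp

lemma closed_csubspace_projection:
  assumes "closed S" "csubspace S"
  obtains y where "y \<in> S" "\<And>s. s \<in> S \<Longrightarrow> cinner (x - y) s = 0"
proof -
  obtain y where y: "y \<in> S" "\<And>s. s \<in> S \<Longrightarrow> inner (x - y) s = 0"
    using closed_subspace_projection[OF assms(1) csubspace_imp_subspace[OF assms(2)], of x] by blast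
  have "cinner (x - y) s = 0" if "s \<in> S" for s
    using y(2)[OF that] y(2)[OF csubspaceD(3)[OF assms(2) that], of \<i>]
    by (simp only: complex_eq_iff Im_cinner inner_eq_Re_cinner zero_complex.sel)
  then show thesis using that y by blast
qed

text \<open>A complex-linear functional is determined by its real part, since its imaginary part at
  x is minus its real part at i x.\<close>

lemma cRiesz_representation:
  assumes add: "\<And>x y. f (x + y) = f x + f y" and scale: "\<And>c x. f (c *\<^sub>C x) = c * f x"
    and bound: "\<And>x. cmod (f x) \<le> C * norm x"
  obtains y :: "'a ell2" where "\<And>x. f x = cinner x y"
proof -
  have "bounded_linear (\<lambda>x. Re (f x))"
  proof (rule bounded_linear_intro[where K = C])
    show "norm (Re (f x)) \<le> norm x * C" for x
      using abs_Re_le_cmod[of "f x"] bound[of x] by (simp add: mult.commute)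
  qed (simp_all add: add scale scaleR_ell2_scaleC)
  then obtain y where y: "\<And>x. Re (f x) = inner x y" by (rule Riesz_representation) blast
  have "f x = cinner x y" for x
  proof (rule complex_eqI)
    show "Re (f x) = Re (cinner x y)" by (simp add: y inner_eq_Re_cinner)
    have "Im (f x) = - Re (f (\<i> *\<^sub>C x))" by (simp add: scale)
    also have "\<dots> = Im (cinner x y)" unfolding y inner_eq_Re_cinner by simp
    finally show "Im (f x) = Im (cinner x y)" .
  qed
  then show thesis using that by blast
qed

lemma tendsto_cinner_left:
  assumes "X \<longlonglongrightarrow> x" shows "(\<lambda>n. cinner (X n) y) \<longlonglongrightarrow> cinner x y"
proof (rule Lim_null[THEN iffD2], rule Lim_null_comparison)
  show "\<forall>\<^sub>F n in sequentially. norm (cinner (X n) y - cinner x y) \<le> norm (X n - x) * norm y"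
    by (simp add: cinner_diff_left[symmetric] cmod_cinner_le)
  show "(\<lambda>n. norm (X n - x) * norm y) \<longlonglongrightarrow> 0"
    using tendsto_mult_left_zero[OF tendsto_norm_zero[OF Lim_null[THEN iffD1, OF assms]]] .
qed

lemma closed_csubspace_orthogonal:
  "closed {x. \<forall>s\<in>S. cinner x s = 0}" "csubspace {x. \<forall>s\<in>S. cinner x s = 0}"
proof -
  show "closed {x. \<forall>s\<in>S. cinner x s = 0}"
    unfolding closed_sequential_limits
  proof (intro allI impI)
    fix X x assume X: "(\<forall>n. X n \<in> {x. \<forall>s\<in>S. cinner x s = 0}) \<and> X \<longlonglongrightarrow> x"
    have "cinner x s = 0" if "s \<in> S" for s
    proof -
      have "(\<lambda>n. 0) \<longlonglongrightarrow> cinner x s"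
        using tendsto_cinner_left[of X x s] X that by simp
      then show ?thesis by (simp add: LIMSEQ_const_iff)
    qed
    then show "x \<in> {x. \<forall>s\<in>S. cinner x s = 0}" by simp
  qed
  show "csubspace {x. \<forall>s\<in>S. cinner x s = 0}"
    by (auto simp: csubspace_def cinner_add_left)
qed

text \<open>A closed subspace is its own double complement, here relative to \<open>L\<close>; the
  vector to test against is the difference of \<open>x\<close> and its projection. This is the dual
  form of density that the converse relies on.\<close>

lemma mem_if_orthogonal_to_orthogonal:
  assumes "closed S" "csubspace S" "S \<subseteq> L" "csubspace L" "x \<in> L"
    and "\<And>y. y \<in> L \<Longrightarrow> (\<And>s. s \<in> S \<Longrightarrow> cinner y s = 0) \<Longrightarrow> cinner x y = 0"
  shows "x \<in> S"
proof -
  obtain y where y: "y \<in> S" "\<And>s. s \<in> S \<Longrightarrow> cinner (x - y) s = 0"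
    using closed_csubspace_projection[OF assms(1,2)] by blast
  have "x - y \<in> L" using assms y by (auto intro: csubspaceD)
  then have "cinner x (x - y) = 0" using assms(6) y(2) by blast
  moreover have "cinner y (x - y) = 0" using y cinner_eq_0_commute by blast
  ultimately have "cinner (x - y) (x - y) = 0" by (simp only: cinner_diff_left) simp
  then have "x - y = 0" by (rule cinner_self_eq_0[THEN iffD1])
  then show ?thesis using y(1) by simp
qed

section \<open>Bounded multipliers\<close>

text \<open>Orthogonality of the characters of the cyclic group of order \<open>N\<close>; the
  factor \<open>N\<close> comes from their norms.\<close>

lemma DFT_parseval:
  fixes a :: "nat \<Rightarrow> complex"
  assumes "N > 0"
  shows "(\<Sum>k<N. (cmod (\<Sum>n<N. a n * cis (2 * pi * real k / real N) ^ n))\<^sup>2) =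
    real N * (\<Sum>n<N. (cmod (a n))\<^sup>2)"
proof -
  define u where "u n = cis (2 * pi * real n / real N)" for n
  have pow: "u k ^ n = u n ^ k" for k n
    by (simp add: u_def Complex.DeMoivre field_simps)
  have unit: "u n * cnj (u n) = 1" for n
    by (simp add: u_def cis_mult cis_cnj)
  have orth: "(\<Sum>k<N. u k ^ n * cnj (u k ^ l)) = (if n = l then of_nat N else 0)"
    if "n < N" "l < N" for n l
  proof -
    \<comment> \<open>By \<open>pow\<close> the summands become powers of the single number
      \<open>w\<close>. For distinct \<open>n\<close> and \<open>l\<close> it is an
      \<open>N\<close>-th root of unity other than 1, so the geometric sum vanishes.\<close>
    define w where "w = u n * cnj (u l)"
    have eq: "u k ^ n * cnj (u k ^ l) = w ^ k" for k
      by (simp only: pow[of k]) (simp add: w_def power_mult_distrib)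
    show ?thesis
    proof (cases "n = l")
      case True
      then show ?thesis unfolding eq by (simp add: w_def unit)
    next
      case False
      have "w \<noteq> 1"
      proof
        assume "w = 1"
        then have "u n = u l" using unit[of l]
          by (metis mult.assoc mult.commute mult.right_neutral w_def)
        then show False
          using Complex.bij_betw_roots_unity[OF assms] that False
          unfolding bij_betw_def inj_on_def u_def by blast
      qed
      moreover have "w ^ N = 1"
      proof -
        have "u j ^ N = 1" for j
          using assms cis_multiple_2pi[of "real j"] by (simp add: u_def Complex.DeMoivre mult.assoc)
        then show ?thesis by (simp add: w_def power_mult_distrib flip: complex_cnj_power)
      qed
      ultimately show ?thesis using False unfolding eq by (simp add: geometric_sum)
    qed
  qed
  have "complex_of_real (\<Sum>k<N. (cmod (\<Sum>n<N. a n * u k ^ n))\<^sup>2) =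
    (\<Sum>k<N. (\<Sum>n<N. a n * u k ^ n) * cnj (\<Sum>l<N. a l * u k ^ l))"
    by (simp only: of_real_sum complex_norm_square)
  also have "\<dots> = (\<Sum>k<N. \<Sum>n<N. \<Sum>l<N. a n * cnj (a l) * (u k ^ n * cnj (u k ^ l)))"
    unfolding cnj_sum sum_product by (intro sum.cong refl) (simp add: mult_ac)
  also have "\<dots> = (\<Sum>n<N. \<Sum>l<N. a n * cnj (a l) * (\<Sum>k<N. u k ^ n * cnj (u k ^ l)))"
    unfolding sum_distrib_left
    by (subst sum.swap, rule sum.cong[OF refl], subst sum.swap, rule refl)
  also have "\<dots> = (\<Sum>n<N. \<Sum>l<N. if n = l then a n * cnj (a n) * of_nat N else 0)"
    by (intro sum.cong refl) (simp add: orth del: complex_cnj_power)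
  also have "\<dots> = complex_of_real (real N * (\<Sum>n<N. (cmod (a n))\<^sup>2))"
    by (simp add: complex_norm_square sum_distrib_left mult.commute del: of_real_power)
  finally show ?thesis unfolding of_real_eq_iff u_def .
qed

lemma poly_sum_lessThan:
  fixes p :: "'a::comm_ring_1 poly"
  assumes "degree p < N"
  shows "poly p z = (\<Sum>n<N. coeff p n * z ^ n)"
proof -
  have "{..degree p} \<subseteq> {..<N}" using assms by auto
  then show ?thesis unfolding Polynomial.poly_altdef
    by (intro sum.mono_neutral_left) (auto simp: coeff_eq_0)
qed

text \<open>The mean over \<open>N\<close> equally spaced points of the circle of radius
  \<open>r\<close> plays the role of the integral mean; it is exact because the degree stays below
  \<open>N\<close>.\<close>

lemma poly_parseval:
  fixes p :: "complex poly" and r :: real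
  assumes "degree p < N"
  shows "(\<Sum>k<N. (cmod (poly p (of_real r * cis (2 * pi * real k / real N))))\<^sup>2) =
    real N * (\<Sum>n<N. (cmod (coeff p n))\<^sup>2 * r ^ (2 * n))"
proof -
  have "N > 0" using assms by auto
  have "poly p (of_real r * z) = (\<Sum>n<N. (coeff p n * of_real r ^ n) * z ^ n)" for z
    by (simp add: poly_sum_lessThan[OF assms] power_mult_distrib mult.assoc)
  moreover have "(cmod (coeff p n * of_real r ^ n))\<^sup>2 = (cmod (coeff p n))\<^sup>2 * r ^ (2 * n)" for n
    by (simp add: norm_mult norm_power power_mult_distrib power_mult power_mult[of _ n 2, symmetric]
        mult.commute[of n 2])
  ultimately show ?thesis by (simp only: DFT_parseval[OF \<open>N > 0\<close>])
qed

text \<open>Partial sums of a bounded function need not obey its bound on the whole disc, but on a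
  smaller disc they converge uniformly, which costs only \<open>e\<close>. The condition
  \<open>M \<ge> L\<close> keeps the first \<open>L\<close> coefficients intact.\<close>

lemma fps_expansion_truncation_bound:
  assumes hol: "h holomorphic_on ball 0 1" and bound: "\<And>z. z \<in> ball 0 1 \<Longrightarrow> cmod (h z) \<le> B"
    and "0 \<le> r" "r < 1" "e > 0"
  obtains M where "M \<ge> L"
    "\<And>z. cmod z \<le> r \<Longrightarrow> cmod (\<Sum>n<M. fps_nth (fps_expansion h 0) n * z ^ n) \<le> B + e"
proof -
  define c where "c n = fps_nth (fps_expansion h 0) n" for n
  have sums: "(\<lambda>n. c n * z ^ n) sums h z" if "z \<in> ball 0 1" for z
    using holomorphic_power_series[OF hol that] by (simp add: c_def fps_expansion_def)
  have "summable (\<lambda>n. norm (c n * of_real r ^ n))"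
  proof (rule powser_insidea)
    \<comment> \<open>A point strictly between \<open>r\<close> and 1, where the series converges,
      gives absolute convergence at \<open>r\<close>.\<close>
    show "summable (\<lambda>n. c n * complex_of_real ((1 + r) / 2) ^ n)"
      using assms by (intro sums_summable[OF sums]) (simp only: mem_ball_0 norm_of_real, simp)
    show "norm (complex_of_real r) < norm (complex_of_real ((1 + r) / 2))"
      using assms by (simp only: norm_of_real) simp
  qed
  then have "uniform_limit (cball 0 r) (\<lambda>n z. \<Sum>i<n. c i * z ^ i) (\<lambda>z. \<Sum>i. c i * z ^ i) sequentially"
    using \<open>0 \<le> r\<close>
    by (intro Weierstrass_m_test) (auto simp: norm_mult norm_power intro!: mult_left_mono power_mono)
  then have "\<forall>\<^sub>F n in sequentially. \<forall>z\<in>cball 0 r. dist (\<Sum>i<n. c i * z ^ i) (\<Sum>i. c i * z ^ i) < e"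
    using \<open>e > 0\<close> by (rule uniform_limitD)
  then obtain M where M: "\<And>n z. n \<ge> M \<Longrightarrow> z \<in> cball 0 r \<Longrightarrow> dist (\<Sum>i<n. c i * z ^ i) (\<Sum>i. c i * z ^ i) < e"
    unfolding eventually_sequentially by blast
  have "cmod (\<Sum>i<max L M. c i * z ^ i) \<le> B + e" if "cmod z \<le> r" for z
  proof -
    have z: "z \<in> ball 0 1" using that \<open>r < 1\<close> by simp
    have "dist (\<Sum>i<max L M. c i * z ^ i) (h z) < e"
      using M[of "max L M" z] that sums_unique[OF sums[OF z]] by simp
    then show ?thesis
      using bound[OF z] norm_triangle_sub[of "\<Sum>i<max L M. c i * z ^ i" "h z"]
      by (simp add: dist_norm)
  qed
  then show thesis using that[of "max L M"] by (simp add: c_def)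
qed

text \<open>
  Parseval on the circle of radius \<open>r\<close> for the product of two polynomials, one of them a
  partial sum of \<open>h\<close>, replaces integration; then \<open>r\<close> tends to \<open>1\<close>.
\<close>

lemma multiplier_bound:
  assumes hol: "h holomorphic_on ball 0 1" and bound: "\<And>z. z \<in> ball 0 1 \<Longrightarrow> cmod (h z) \<le> B"
  shows "(\<Sum>n<L. (cmod (fps_nth (fps_expansion h 0 * f) n))\<^sup>2) \<le> B\<^sup>2 * (\<Sum>n<L. (cmod (fps_nth f n))\<^sup>2)"
proof -
  let ?y = "fps_nth (fps_expansion h 0 * f)" and ?x = "fps_nth f"
  have "0 \<le> B" using bound[of 0] order_trans[OF norm_ge_zero] by force
  have main: "(\<Sum>n<L. (cmod (?y n))\<^sup>2 * r ^ (2 * n)) \<le> (B + e)\<^sup>2 * (\<Sum>n<L. (cmod (?x n))\<^sup>2)"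
    if r: "0 \<le> r" "r < 1" "e > 0" for r e
  proof -
    obtain M where M: "M \<ge> L"
      "\<And>z. cmod z \<le> r \<Longrightarrow> cmod (\<Sum>n<M. fps_nth (fps_expansion h 0) n * z ^ n) \<le> B + e"
      by (rule fps_expansion_truncation_bound[OF hol bound r, where L = L]) blast+
    define p where "p = (\<Sum>n<M. monom (fps_nth (fps_expansion h 0) n) n)"
    define q where "q = (\<Sum>n<L. monom (?x n) n)"
    \<comment> \<open>More sample points than the degree of \<open>p * q\<close>, so that
      \<open>poly_parseval\<close> applies to the product as well as to \<open>q\<close>.\<close>
    define N where "N = Suc (M + L)"
    have cp: "coeff p n = (if n < M then fps_nth (fps_expansion h 0) n else 0)" for n
      by (auto simp: p_def coeff_sum)
    have cq: "coeff q n = (if n < L then ?x n else 0)" for n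
      by (auto simp: q_def coeff_sum)
    \<comment> \<open>Coefficients of a product below \<open>L\<close> see only coefficients of the
      factors below \<open>L\<close>. Hence \<open>f\<close> may be an arbitrary formal series and
      the same \<open>L\<close> appears on both sides.\<close>
    have y: "coeff (p * q) n = ?y n" if "n < L" for n
      unfolding coeff_mult fps_mult_nth atMost_atLeast0
      using that M(1) by (intro sum.cong refl) (auto simp: cp cq)
    have "degree p \<le> M" "degree q \<le> L"
      by (intro degree_le; simp add: cp cq)+
    then have deg: "degree (p * q) < N" "degree q < N"
      using degree_mult_le[of p q] by (auto simp: N_def)
    have norm_p: "cmod (poly p z) \<le> B + e" if "cmod z \<le> r" for z
      using M(2)[OF that] by (simp add: p_def poly_sum poly_monom)
    let ?z = "\<lambda>k. complex_of_real r * cis (2 * pi * real k / real N)"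
    have "real N * (\<Sum>n<L. (cmod (?y n))\<^sup>2 * r ^ (2 * n)) =
        real N * (\<Sum>n<L. (cmod (coeff (p * q) n))\<^sup>2 * r ^ (2 * n))"
      by (simp add: y)
    also have "\<dots> \<le> real N * (\<Sum>n<N. (cmod (coeff (p * q) n))\<^sup>2 * r ^ (2 * n))"
      using r by (intro mult_left_mono sum_mono2) (auto simp: N_def)
    also have "\<dots> = (\<Sum>k<N. (cmod (poly (p * q) (?z k)))\<^sup>2)"
      by (rule poly_parseval[OF deg(1), symmetric])
    also have "\<dots> \<le> (\<Sum>k<N. (B + e)\<^sup>2 * (cmod (poly q (?z k)))\<^sup>2)"
      using r by (intro sum_mono)
        (auto simp: norm_mult power_mult_distrib intro!: mult_right_mono power_mono norm_p)
    also have "\<dots> = (B + e)\<^sup>2 * (real N * (\<Sum>n<N. (cmod (coeff q n))\<^sup>2 * r ^ (2 * n)))"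
      unfolding poly_parseval[OF deg(2), symmetric] by (simp add: sum_distrib_left)
    also have "(\<Sum>n<N. (cmod (coeff q n))\<^sup>2 * r ^ (2 * n)) = (\<Sum>n<L. (cmod (?x n))\<^sup>2 * r ^ (2 * n))"
      by (intro sum.mono_neutral_cong_right) (auto simp: cq N_def)
    also have "(B + e)\<^sup>2 * (real N * \<dots>) \<le> (B + e)\<^sup>2 * (real N * (\<Sum>n<L. (cmod (?x n))\<^sup>2))"
      using r by (intro mult_left_mono sum_mono mult_left_le) (auto intro: power_le_one)
    finally have "real N * (\<Sum>n<L. (cmod (?y n))\<^sup>2 * r ^ (2 * n)) \<le>
      real N * ((B + e)\<^sup>2 * (\<Sum>n<L. (cmod (?x n))\<^sup>2))"
      by (simp add: mult_ac)
    then show ?thesis by (rule mult_left_le_imp_le) (simp add: N_def)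
  qed
  have e: "(\<lambda>k. inverse (real (Suc k))) \<longlonglongrightarrow> 0" by (rule LIMSEQ_inverse_real_of_nat)
  \<comment> \<open>Both limits are taken at once, with \<open>r = 1 - e\<close> and
    \<open>e\<close> running through the inverses of the positive integers.\<close>
  have "(\<Sum>n<L. (cmod (?y n))\<^sup>2 * (1 - 0) ^ (2 * n)) \<le> (B + 0)\<^sup>2 * (\<Sum>n<L. (cmod (?x n))\<^sup>2)"
  proof (rule LIMSEQ_le)
    show "(\<lambda>k. \<Sum>n<L. (cmod (?y n))\<^sup>2 * (1 - inverse (real (Suc k))) ^ (2 * n))
      \<longlonglongrightarrow> (\<Sum>n<L. (cmod (?y n))\<^sup>2 * (1 - 0) ^ (2 * n))"
      by (intro tendsto_sum tendsto_mult tendsto_power tendsto_diff tendsto_const e)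
    show "(\<lambda>k. (B + inverse (real (Suc k)))\<^sup>2 * (\<Sum>n<L. (cmod (?x n))\<^sup>2))
      \<longlonglongrightarrow> (B + 0)\<^sup>2 * (\<Sum>n<L. (cmod (?x n))\<^sup>2)"
      by (intro tendsto_mult tendsto_power tendsto_add tendsto_const e)
    have "inverse (real (Suc k)) \<le> 1" for k by (simp add: inverse_eq_divide)
    then show "\<exists>K. \<forall>k\<ge>K. (\<Sum>n<L. (cmod (?y n))\<^sup>2 * (1 - inverse (real (Suc k))) ^ (2 * n))
        \<le> (B + inverse (real (Suc k)))\<^sup>2 * (\<Sum>n<L. (cmod (?x n))\<^sup>2)"
      by (intro exI[of _ 0] allI impI main) simp_all
  qed
  then show ?thesis by simp
qed

section \<open>Vector-valued Hardy space as a sequence space\<close>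

lemma summable_on_extend:
  fixes f :: "'b \<Rightarrow> real"
  assumes "inj g" "\<And>b. b \<notin> range g \<Longrightarrow> f b = 0"
  shows "f summable_on UNIV \<longleftrightarrow> (\<lambda>a. f (g a)) summable_on UNIV"
proof -
  have "f summable_on UNIV \<longleftrightarrow> f summable_on range g"
    by (rule summable_on_cong_neutral) (use assms(2) in auto)
  also have "\<dots> \<longleftrightarrow> (\<lambda>a. f (g a)) summable_on UNIV"
    using summable_on_reindex[OF assms(1), of f] by (simp add: comp_def)
  finally show ?thesis .
qed

text \<open>Junk value: \<open>pull g\<close> and \<open>push g\<close> are zero unless \<open>g\<close> is injective.\<close>

lift_definition pull :: "('a \<Rightarrow> 'b) \<Rightarrow> 'b ell2 \<Rightarrow> 'a ell2"
  is "\<lambda>g f a. if inj g then f (g a) else 0"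
proof -
  fix g :: "'a \<Rightarrow> 'b" and f :: "'b \<Rightarrow> complex"
  assume f: "(\<lambda>a. (cmod (f a))\<^sup>2) summable_on UNIV"
  have "(\<lambda>a. (cmod (f (g a)))\<^sup>2) summable_on UNIV" if "inj g"
    using summable_on_reindex[OF that, of "\<lambda>a. (cmod (f a))\<^sup>2"] summable_on_subset_banach[OF f, of "range g"]
    by (simp add: comp_def)
  then show "(\<lambda>a. (cmod (if inj g then f (g a) else 0))\<^sup>2) summable_on UNIV"
    by (cases "inj g") simp_all
qed

lift_definition push :: "('a \<Rightarrow> 'b) \<Rightarrow> 'a ell2 \<Rightarrow> 'b ell2"
  is "\<lambda>g f b. if inj g \<and> b \<in> range g then f (inv_into UNIV g b) else 0"
proof -
  fix g :: "'a \<Rightarrow> 'b" and f :: "'a \<Rightarrow> complex"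
  assume f: "(\<lambda>a. (cmod (f a))\<^sup>2) summable_on UNIV"
  show "(\<lambda>b. (cmod (if inj g \<and> b \<in> range g then f (inv_into UNIV g b) else 0))\<^sup>2) summable_on UNIV"
  proof (cases "inj g")
    case True
    then show ?thesis by (subst summable_on_extend[of g]) (use f in auto)
  qed simp
qed

lemma cf_pull: "inj g \<Longrightarrow> cf (pull g x) a = cf x (g a)"
  by (simp add: pull.rep_eq)

lemma cf_push: "inj g \<Longrightarrow> cf (push g x) (g a) = cf x a"
  by (simp add: push.rep_eq)

lemma cf_push_notin: "b \<notin> range g \<Longrightarrow> cf (push g x) b = 0"
  by (simp add: push.rep_eq)

lemma pull_push: "inj g \<Longrightarrow> pull g (push g x) = x"
  by (rule ell2_eqI) (simp add: cf_pull cf_push)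

lemma push_add: "push g (x + y) = push g x + push g y"
  and push_diff: "push g (x - y) = push g x - push g y"
  by (rule ell2_eqI; simp add: push.rep_eq)+

lemma push_0 [simp]: "push g 0 = 0"
  by (rule ell2_eqI) (simp add: push.rep_eq)

lemma push_sum: "push g (sum f A) = (\<Sum>i\<in>A. push g (f i))"
  by (induction A rule: infinite_finite_induct) (simp_all add: push_add)

text \<open>The source of two adjoint pairs below: the shift with the backward shift, and the
  embedding of a component with its extraction.\<close>

lemma cinner_push:
  assumes "inj g" shows "cinner (push g x) y = cinner x (pull g y)"
proof -
  have "cinner (push g x) y = (\<Sum>\<^sub>\<infinity>b\<in>range g. cf (push g x) b * cnj (cf y b))"
    unfolding cinner_def by (rule infsum_cong_neutral) (auto simp: cf_push_notin)
  also have "\<dots> = cinner x (pull g y)"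
    unfolding cinner_def using assms
    by (simp add: infsum_reindex comp_def cf_push cf_pull)
  finally show ?thesis .
qed

lemma norm_push: "inj g \<Longrightarrow> norm (push g x) = norm x"
  by (simp add: norm_eq_sqrt_inner inner_eq_Re_cinner cinner_push pull_push)

lemma norm_pull_le: "norm (pull g x) \<le> norm x"
proof (cases "inj g")
  case True
  show ?thesis
  proof (rule norm_le_if_sum_cf_le)
    fix A :: "'a set" assume "finite A"
    have "(\<Sum>a\<in>A. (cmod (cf (pull g x) a))\<^sup>2) = (\<Sum>b\<in>g ` A. (cmod (cf x b))\<^sup>2)"
      using True by (simp add: cf_pull sum.reindex inj_on_subset)
    also have "\<dots> \<le> (norm x)\<^sup>2" using \<open>finite A\<close> by (intro sum_cf_le_norm) simp
    finally show "(\<Sum>a\<in>A. (cmod (cf (pull g x) a))\<^sup>2) \<le> (norm x)\<^sup>2" .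
  qed simp
next
  case False
  then have "pull g x = 0" by (intro ell2_eqI) (simp add: pull.rep_eq)
  then show ?thesis by simp
qed

lemma tendsto_cf: "X \<longlonglongrightarrow> x \<Longrightarrow> (\<lambda>n. cf (X n) a) \<longlonglongrightarrow> cf x a"
proof (rule Lim_null[THEN iffD2], rule Lim_null_comparison)
  assume "X \<longlonglongrightarrow> x"
  then show "(\<lambda>n. norm (X n - x)) \<longlonglongrightarrow> 0"
    by (intro tendsto_norm_zero Lim_null[THEN iffD1])
  show "\<forall>\<^sub>F n in sequentially. norm (cf (X n) a - cf x a) \<le> norm (X n - x)"
    using cmod_cf_le_norm[of "X _ - x" a] by simp
qed

lemma closed_cf_eq_0: "closed {x. \<forall>a\<in>A. cf x a = 0}"
  unfolding closed_sequential_limits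
proof (intro allI impI)
  fix X x assume X: "(\<forall>n. X n \<in> {x. \<forall>a\<in>A. cf x a = 0}) \<and> X \<longlonglongrightarrow> x"
  have "cf x a = 0" if "a \<in> A" for a
    using tendsto_cf[of X x a] X that by (simp add: LIMSEQ_const_iff)
  then show "x \<in> {x. \<forall>a\<in>A. cf x a = 0}" by simp
qed

lemma csubspace_cf_eq_0: "csubspace {x. \<forall>a\<in>A. cf x a = 0}"
  by (auto simp: csubspace_def)

text \<open>
  The entry at \<open>(i, n)\<close> is the \<open>n\<close>-th Taylor coefficient of the \<open>i\<close>-th component, so
  \<open>hardy m\<close> is the Hardy space with values in \<open>\<complex>\<^sup>m\<close>.
\<close>

type_synonym coeffs = "(nat \<times> nat) ell2"

definition hardy :: "nat \<Rightarrow> coeffs set" where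
  "hardy m = {x. \<forall>a\<in>{m..} \<times> UNIV. cf x a = 0}"

lemma hardy_iff: "x \<in> hardy m \<longleftrightarrow> (\<forall>i n. m \<le> i \<longrightarrow> cf x (i, n) = 0)"
  by (auto simp: hardy_def)

lemma closed_hardy: "closed (hardy m)" and csubspace_hardy: "csubspace (hardy m)"
  unfolding hardy_def by (rule closed_cf_eq_0 csubspace_cf_eq_0)+

definition fshift :: "coeffs \<Rightarrow> coeffs" where "fshift = push (apsnd Suc)"
definition bwshift :: "coeffs \<Rightarrow> coeffs" where "bwshift = pull (apsnd Suc)"
definition component :: "nat \<Rightarrow> coeffs \<Rightarrow> nat ell2" where "component i = pull (Pair i)"
definition embed :: "nat \<Rightarrow> nat ell2 \<Rightarrow> coeffs" where "embed i = push (Pair i)"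

lemma inj_apsnd_Suc: "inj (apsnd Suc)" by (auto simp: inj_def)
lemma inj_Pair: "inj (Pair i)" by (auto simp: inj_def)

lemma cf_fshift: "cf (fshift x) (i, n) = (case n of 0 \<Rightarrow> 0 | Suc l \<Rightarrow> cf x (i, l))"
proof (cases n)
  case 0
  have "(i, 0) \<notin> range (apsnd Suc)" by auto
  then show ?thesis by (simp add: 0 fshift_def cf_push_notin)
next
  case (Suc l)
  then show ?thesis using cf_push[OF inj_apsnd_Suc, of x "(i, l)"] by (simp add: fshift_def)
qed

lemma cf_bwshift [simp]: "cf (bwshift x) (i, n) = cf x (i, Suc n)"
  by (simp add: bwshift_def cf_pull inj_apsnd_Suc)

lemma cf_component [simp]: "cf (component i x) n = cf x (i, n)"
  by (simp add: component_def cf_pull inj_Pair)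

lemma cf_embed: "cf (embed i y) (j, n) = (if i = j then cf y n else 0)"
  using cf_push[OF inj_Pair, of i y n] cf_push_notin[of "(j, n)" "Pair i" y]
  by (auto simp: embed_def)

lemma cinner_fshift: "cinner (fshift x) y = cinner x (bwshift y)"
  by (simp add: fshift_def bwshift_def cinner_push inj_apsnd_Suc)

lemma norm_fshift: "norm (fshift x) = norm x"
  by (simp add: fshift_def norm_push inj_apsnd_Suc)

lemma bwshift_fshift: "bwshift (fshift x) = x"
  by (simp add: fshift_def bwshift_def pull_push inj_apsnd_Suc)

lemma fshift_bwshift: "(\<And>i. cf x (i, 0) = 0) \<Longrightarrow> fshift (bwshift x) = x"
  by (rule ell2_eqI) (auto simp: cf_fshift split: nat.split simp del: split_paired_All)

lemma fshift_hardy: "x \<in> hardy m \<Longrightarrow> fshift x \<in> hardy m"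
  by (auto simp: hardy_iff cf_fshift split: nat.split)

lemma bwshift_hardy: "x \<in> hardy m \<Longrightarrow> bwshift x \<in> hardy m"
  by (auto simp: hardy_iff)

lemma fshift_add: "fshift (x + y) = fshift x + fshift y"
  and fshift_diff: "fshift (x - y) = fshift x - fshift y"
  and fshift_sum: "fshift (sum f A) = (\<Sum>i\<in>A. fshift (f i))"
  by (simp_all add: fshift_def push_add push_diff push_sum)

lemma hardy_eq_sum: "x \<in> hardy m \<Longrightarrow> x = (\<Sum>i<m. embed i (component i x))"
  by (rule ell2_eqI) (auto simp: hardy_iff cf_embed)

lemma cinner_embed: "cinner (embed i y) x = cinner y (component i x)"
  by (simp add: embed_def component_def cinner_push inj_Pair)

lemma cinner_hardy: "x \<in> hardy m \<Longrightarrow> cinner x y = (\<Sum>i<m. cinner (component i x) (component i y))"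
  by (subst hardy_eq_sum) (auto simp: cinner_sum_left cinner_embed)

section \<open>Finite orthonormal systems\<close>

lemma power2_norm_eq_cinner: "(norm x)\<^sup>2 = Re (cinner x x)"
  by (simp add: cinner_self)

lemma norm_sum_orthonormal:
  fixes w :: "nat \<Rightarrow> 'a ell2"
  assumes "\<And>i j. i < r \<Longrightarrow> j < r \<Longrightarrow> cinner (w i) (w j) = (if i = j then 1 else 0)"
  shows "(norm (\<Sum>j<r. c j *\<^sub>C w j))\<^sup>2 = (\<Sum>j<r. (cmod (c j))\<^sup>2)"
proof -
  have "cinner (\<Sum>j<r. c j *\<^sub>C w j) (\<Sum>j<r. c j *\<^sub>C w j) = (\<Sum>i<r. \<Sum>j<r. if i = j then c i * cnj (c i) else 0)"
    unfolding cinner_sum_left cinner_sum_right by (intro sum.cong refl) (simp add: assms)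
  then show ?thesis
    by (simp add: power2_norm_eq_cinner complex_norm_square[symmetric] del: of_real_power)
qed

lemma norm_add_orthogonal:
  fixes x y :: "'a ell2"
  assumes "cinner x y = 0"
  shows "(norm (x + y))\<^sup>2 = (norm x)\<^sup>2 + (norm y)\<^sup>2"
proof -
  have "cinner y x = 0" using assms cinner_eq_0_commute by blast
  then show ?thesis
    unfolding power2_norm_eq_cinner by (simp add: cinner_add_left cinner_add_right assms)
qed

lemma cinner_sum_orthonormal:
  fixes w :: "nat \<Rightarrow> 'a ell2"
  assumes "\<And>i j. i < r \<Longrightarrow> j < r \<Longrightarrow> cinner (w i) (w j) = (if i = j then 1 else 0)" "l < r"
  shows "cinner (\<Sum>j<r. c j *\<^sub>C w j) (w l) = c l"
proof -
  have "cinner (\<Sum>j<r. c j *\<^sub>C w j) (w l) = (\<Sum>j<r. if j = l then c j else 0)"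
    unfolding cinner_sum_left by (intro sum.cong refl) (simp add: assms)
  then show ?thesis using assms(2) by simp
qed

section \<open>The representation in sequence space\<close>

text \<open>The \<open>w j\<close> and \<open>e j\<close> stand for the orthonormal bases of the
  statement. Multiplication operators do not occur here: \<open>T\<close> enters through the
  relation with its adjoint and through \<open>T_rec\<close>, which splits off the constant terms of
  \<open>k\<close>.\<close>

locale defect_setting =
  fixes m r p :: nat and M :: "coeffs set" and w e :: "nat \<Rightarrow> coeffs" and T T' :: "coeffs \<Rightarrow> coeffs"
  assumes M: "closed M" "csubspace M" "M \<subseteq> hardy m"
    and w_mem: "\<And>j. j < r \<Longrightarrow> w j \<in> M"
    and w_orthonormal: "\<And>i j. i < r \<Longrightarrow> j < r \<Longrightarrow> cinner (w i) (w j) = (if i = j then 1 else 0)"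
    and w_orthogonal: "\<And>j x. j < r \<Longrightarrow> x \<in> M \<Longrightarrow> (\<And>i. cf x (i, 0) = 0) \<Longrightarrow> cinner (w j) x = 0"
    and w_span: "\<And>x. x \<in> M \<Longrightarrow> (\<And>y. y \<in> M \<Longrightarrow> (\<And>i. cf y (i, 0) = 0) \<Longrightarrow> cinner x y = 0)
      \<Longrightarrow> \<exists>c. x = (\<Sum>j<r. c j *\<^sub>C w j)"
    and e_hardy: "\<And>j. j < p \<Longrightarrow> e j \<in> hardy m"
    and e_orthonormal: "\<And>i j. i < p \<Longrightarrow> j < p \<Longrightarrow> cinner (e i) (e j) = (if i = j then 1 else 0)"
    and e_orthogonal: "\<And>j x. j < p \<Longrightarrow> x \<in> M \<Longrightarrow> cinner (e j) x = 0"
    and T_hardy: "\<And>k. k \<in> hardy (r + p) \<Longrightarrow> T k \<in> hardy m"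
    and T'_hardy: "\<And>g. g \<in> hardy m \<Longrightarrow> T' g \<in> hardy (r + p)"
    and adjoint: "\<And>k g. k \<in> hardy (r + p) \<Longrightarrow> g \<in> hardy m \<Longrightarrow> cinner (T k) g = cinner k (T' g)"
    and T_rec: "\<And>k. k \<in> hardy (r + p) \<Longrightarrow> T k = (\<Sum>j<r. cf k (j, 0) *\<^sub>C w j) +
      fshift (T (bwshift k) + (\<Sum>j<p. cf k (r + j, 0) *\<^sub>C e j))"
begin

lemma sum_w_mem: "(\<Sum>j<r. c j *\<^sub>C w j) \<in> M"
  using M(2) w_mem by (auto intro: csubspace_sum csubspaceD)

lemma sum_e_hardy: "(\<Sum>j<p. c j *\<^sub>C e j) \<in> hardy m"
  using csubspace_hardy e_hardy by (auto intro!: csubspace_sum csubspaceD(3))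

lemma cinner_sum_e: "x \<in> M \<Longrightarrow> cinner (\<Sum>j<p. c j *\<^sub>C e j) x = 0"
  by (simp add: cinner_sum_left e_orthogonal)

lemma cinner_sum_w:
  "x \<in> M \<Longrightarrow> (\<And>i. cf x (i, 0) = 0) \<Longrightarrow> cinner (\<Sum>j<r. c j *\<^sub>C w j) x = 0"
  by (simp add: cinner_sum_left w_orthogonal)

lemma norm_sum_w: "(norm (\<Sum>j<r. c j *\<^sub>C w j))\<^sup>2 = (\<Sum>j<r. (cmod (c j))\<^sup>2)"
  by (rule norm_sum_orthonormal) (rule w_orthonormal)

lemma norm_sum_e: "(norm (\<Sum>j<p. c j *\<^sub>C e j))\<^sup>2 = (\<Sum>j<p. (cmod (c j))\<^sup>2)"
  by (rule norm_sum_orthonormal) (rule e_orthonormal)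

lemma cinner_sum_w_w: "l < r \<Longrightarrow> cinner (\<Sum>j<r. c j *\<^sub>C w j) (w l) = c l"
  by (rule cinner_sum_orthonormal) (rule w_orthonormal)

lemma cinner_sum_e_e: "l < p \<Longrightarrow> cinner (\<Sum>j<p. c j *\<^sub>C e j) (e l) = c l"
  by (rule cinner_sum_orthonormal) (rule e_orthonormal)

text \<open>Projection onto the span of the \<open>w j\<close>, defined on all of
  \<open>coeffs\<close> because the converse applies it to vectors outside \<open>M\<close>.\<close>

definition w_part :: "coeffs \<Rightarrow> coeffs" where
  "w_part x = (\<Sum>j<r. cinner x (w j) *\<^sub>C w j)"

lemma w_part_mem: "w_part x \<in> M" by (simp add: w_part_def sum_w_mem)

lemma cinner_w_part: "j < r \<Longrightarrow> cinner (x - w_part x) (w j) = 0"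
  by (simp add: cinner_diff_left w_part_def cinner_sum_w_w)

text \<open>Let \<open>z\<close> be the projection of \<open>x - w_part x\<close> onto the functions
  in \<open>M\<close> that vanish at 0. What remains is orthogonal to those functions, hence in the
  span of the \<open>w j\<close>, but it is also orthogonal to every \<open>w j\<close>, so it is
  0.\<close>

lemma vanishing_minus_w_part:
  assumes "x \<in> M" shows "cf (x - w_part x) (i, 0) = 0"
proof -
  define Z where "Z = M \<inter> {x. \<forall>a\<in>UNIV \<times> {0}. cf x a = 0}"
  have Z: "closed Z" "csubspace Z"
    unfolding Z_def by (intro closed_Int csubspace_Int M closed_cf_eq_0 csubspace_cf_eq_0)+
  obtain z where z: "z \<in> Z" "\<And>s. s \<in> Z \<Longrightarrow> cinner (x - w_part x - z) s = 0"
    using closed_csubspace_projection[OF Z] by blast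
  define d where "d = x - w_part x - z"
  have "d \<in> M" unfolding d_def using assms z(1) M(2) w_part_mem
    by (auto simp: Z_def intro!: csubspaceD(4))
  moreover have "cinner d s = 0" if "s \<in> M" "\<And>i. cf s (i, 0) = 0" for s
    using z(2)[of s] that by (auto simp: Z_def d_def)
  ultimately obtain c where c: "d = (\<Sum>j<r. c j *\<^sub>C w j)" using w_span by blast
  have "cinner d (w j) = 0" if "j < r" for j
  proof -
    have "cinner (w j) z = 0" using w_orthogonal[OF that] z(1) by (auto simp: Z_def)
    then show ?thesis using cinner_w_part[OF that]
      by (simp add: d_def cinner_diff_left[of _ z] cinner_eq_0_commute[of z])
  qed
  then have "cinner d d = 0" by (subst (2) c) (simp add: cinner_sum_right)
  then have "x - w_part x = z" by (simp add: d_def)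
  then show ?thesis using z(1) by (auto simp: Z_def)
qed

text \<open>The iterates \<open>X n\<close> are not shown to tend to 0. Equality of
  \<open>T (K n)\<close> and \<open>X n\<close> is checked coefficientwise instead, for all
  \<open>n\<close> together, and this also puts \<open>T\<close> of every backward shift of
  \<open>k\<close> into \<open>M\<close>.\<close>

lemma kernel_exists:
  assumes inv: "\<And>x. x \<in> M \<Longrightarrow> (\<And>i. cf x (i, 0) = 0) \<Longrightarrow>
      \<exists>a\<in>M. \<exists>c. bwshift x = a + (\<Sum>j<p. c j *\<^sub>C e j)"
    and "x \<in> M"
  obtains k where "k \<in> hardy (r + p)" "T k = x" "\<And>n. T ((bwshift ^^ n) k) \<in> M"
proof -
  \<comment> \<open>One division step with Pythagoras recorded; the shift preserves the norm, so no
    constant is lost when it is iterated.\<close>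
  define Q where "Q x a u c \<longleftrightarrow> a \<in> M \<and>
      x = (\<Sum>j<r. u j *\<^sub>C w j) + fshift (a + (\<Sum>j<p. c j *\<^sub>C e j)) \<and>
      (norm x)\<^sup>2 = (\<Sum>j<r. (cmod (u j))\<^sup>2) + (norm a)\<^sup>2 + (\<Sum>j<p. (cmod (c j))\<^sup>2)" for x a u c
  have "\<exists>a u c. Q x a u c" if "x \<in> M" for x
  proof -
    define y where "y = x - w_part x"
    have y: "y \<in> M" "\<And>i. cf y (i, 0) = 0"
      unfolding y_def by (rule csubspaceD(4)[OF M(2) that w_part_mem]) (rule vanishing_minus_w_part[OF that])
    obtain a c where ac: "a \<in> M" "bwshift y = a + (\<Sum>j<p. c j *\<^sub>C e j)"
      using inv[OF y] by blast
    have "cinner a (\<Sum>j<p. c j *\<^sub>C e j) = 0"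
      using cinner_sum_e[OF ac(1)] cinner_eq_0_commute by blast
    then have "(norm (bwshift y))\<^sup>2 = (norm a)\<^sup>2 + (\<Sum>j<p. (cmod (c j))\<^sup>2)"
      unfolding ac(2) norm_sum_e[symmetric] by (rule norm_add_orthogonal)
    moreover have "norm y = norm (bwshift y)"
      using norm_fshift[of "bwshift y"] fshift_bwshift[OF y(2)] by simp
    ultimately have ny: "(norm y)\<^sup>2 = (norm a)\<^sup>2 + (\<Sum>j<p. (cmod (c j))\<^sup>2)" by simp
    have "cinner (w_part x) y = 0" unfolding w_part_def by (rule cinner_sum_w[OF y])
    then have "(norm x)\<^sup>2 = (norm (w_part x))\<^sup>2 + (norm y)\<^sup>2"
      using norm_add_orthogonal[of "w_part x" y] by (simp add: y_def)
    then have "(norm x)\<^sup>2 = (\<Sum>j<r. (cmod (cinner x (w j)))\<^sup>2) + (norm a)\<^sup>2 + (\<Sum>j<p. (cmod (c j))\<^sup>2)"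
      unfolding ny w_part_def norm_sum_w by simp
    moreover have "x = (\<Sum>j<r. cinner x (w j) *\<^sub>C w j) + fshift (a + (\<Sum>j<p. c j *\<^sub>C e j))"
      unfolding ac(2)[symmetric] fshift_bwshift[OF y(2)] by (simp add: y_def w_part_def)
    ultimately show ?thesis using ac(1) unfolding Q_def
      by (intro exI[of _ a] exI[of _ "\<lambda>j. cinner x (w j)"] exI[of _ c] conjI)
  qed
  then have "\<exists>t. x \<in> M \<longrightarrow> Q x (fst t) (fst (snd t)) (snd (snd t))" for x
    by (simp add: split_paired_Ex)
  then obtain t where t: "\<And>x. x \<in> M \<Longrightarrow> Q x (fst (t x)) (fst (snd (t x))) (snd (snd (t x)))"
    by metis
  define a u c where "a x = fst (t x)" and "u x = fst (snd (t x))" and "c x = snd (snd (t x))" for x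
  have step:
    "\<And>x. x \<in> M \<Longrightarrow> a x \<in> M"
    "\<And>x. x \<in> M \<Longrightarrow> x = (\<Sum>j<r. u x j *\<^sub>C w j) + fshift (a x + (\<Sum>j<p. c x j *\<^sub>C e j))"
    "\<And>x. x \<in> M \<Longrightarrow>
      (norm x)\<^sup>2 = (\<Sum>j<r. (cmod (u x j))\<^sup>2) + (norm (a x))\<^sup>2 + (\<Sum>j<p. (cmod (c x j))\<^sup>2)"
    using t unfolding Q_def a_def u_def c_def by blast+
  define X where "X n = (a ^^ n) x" for n
  have X: "X n \<in> M" for n
    by (induction n) (simp_all add: X_def \<open>x \<in> M\<close> step(1))
  \<comment> \<open>Column \<open>n\<close> stores the coefficients produced by the
    \<open>n\<close>-th step: those along the \<open>w j\<close> in rows below \<open>r\<close>, the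
    one along \<open>e j\<close> in row \<open>r + j\<close>.\<close>
  define f where "f = (\<lambda>(i, n). if i < r then u (X n) i else if i < r + p then c (X n) (i - r) else 0)"
  have f_sum: "(\<Sum>i<r + p. (cmod (f (i, n)))\<^sup>2) = (norm (X n))\<^sup>2 - (norm (X (Suc n)))\<^sup>2" for n
  proof -
    have "(\<Sum>i<r + p. (cmod (f (i, n)))\<^sup>2) = (\<Sum>i<r. (cmod (f (i, n)))\<^sup>2) + (\<Sum>j<p. (cmod (f (r + j, n)))\<^sup>2)"
      by (induction p) (simp_all add: add.assoc)
    then show ?thesis using step(3)[OF X[of n]] by (simp add: f_def X_def)
  qed
  have "(\<lambda>a. (cmod (f a))\<^sup>2) summable_on UNIV"
  proof (rule square_summable_if_bounded)
    fix A :: "(nat \<times> nat) set" assume "finite A"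
    then obtain N where N: "snd ` A \<subseteq> {..<N}"
      using finite_nat_iff_bounded by blast
    have "(\<Sum>a\<in>A. (cmod (f a))\<^sup>2) = (\<Sum>a\<in>A \<inter> ({..<r + p} \<times> {..<N}). (cmod (f a))\<^sup>2)"
      using \<open>finite A\<close> N by (intro sum.mono_neutral_right) (auto simp: f_def split: if_splits)
    also have "\<dots> \<le> (\<Sum>a\<in>{..<r + p} \<times> {..<N}. (cmod (f a))\<^sup>2)"
      by (intro sum_mono2) auto
    also have "\<dots> = (\<Sum>n<N. \<Sum>i<r + p. (cmod (f (i, n)))\<^sup>2)"
      by (subst sum.swap) (simp add: sum.cartesian_product)
    \<comment> \<open>Each column accounts for the loss of squared norm in one step, so the columns
      telescope.\<close>
    also have "\<dots> = (norm (X 0))\<^sup>2 - (norm (X N))\<^sup>2"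
      unfolding f_sum by (rule sum_lessThan_telescope')
    also have "\<dots> \<le> (norm x)\<^sup>2" by (simp add: X_def)
    finally show "(\<Sum>a\<in>A. (cmod (f a))\<^sup>2) \<le> (norm x)\<^sup>2" .
  qed
  then have cf_f: "cf (Abs_ell2 f) = f" by (simp add: Abs_ell2_inverse)
  define k where "k = Abs_ell2 f"
  define K where "K n = (bwshift ^^ n) k" for n
  have k: "k \<in> hardy (r + p)" unfolding hardy_iff k_def cf_f by (simp add: f_def)
  have K_hardy: "K n \<in> hardy (r + p)" for n
    by (induction n) (simp_all add: K_def k bwshift_hardy)
  have cf_K: "cf (K n) (i, l) = f (i, n + l)" for n i l
    by (induction n arbitrary: l) (simp_all add: K_def k_def cf_f)
  have bwshift_K: "bwshift (K n) = K (Suc n)" for n by (simp add: K_def)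
  \<comment> \<open>The same coefficients occur in both recursions and cancel. Each use of this
    identity gains a factor z, so the difference vanishes to every order.\<close>
  have diff: "X n - T (K n) = fshift (X (Suc n) - T (K (Suc n)))" for n
  proof -
    have TK: "T (K n) = (\<Sum>j<r. u (X n) j *\<^sub>C w j) + fshift (T (K (Suc n)) + (\<Sum>j<p. c (X n) j *\<^sub>C e j))"
      by (subst T_rec[OF K_hardy]) (simp add: cf_K f_def bwshift_K)
    have Xn: "X n = (\<Sum>j<r. u (X n) j *\<^sub>C w j) + fshift (X (Suc n) + (\<Sum>j<p. c (X n) j *\<^sub>C e j))"
      using step(2)[OF X[of n]] by (simp add: X_def)
    show ?thesis
      by (rule trans[OF arg_cong2[where f = minus, OF Xn TK]]) (simp add: fshift_add fshift_diff)
  qed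
  have "cf (X n - T (K n)) (i, l) = 0" for n i l
  proof (induction l arbitrary: n)
    case 0
    show ?case by (subst diff) (simp only: cf_fshift nat.case)
  next
    case (Suc l)
    show ?case by (subst diff) (simp only: cf_fshift nat.case Suc.IH)
  qed
  then have eq: "T (K n) = X n" for n
    by (intro ell2_eqI) (auto simp: prod_eq_iff)
  show thesis
    using that[OF k] eq X eq[of 0] by (simp add: K_def X_def)
qed

text \<open>The relation \<open>adjoint\<close> translates orthogonality of \<open>g\<close> to
  \<open>T k\<close> into orthogonality of \<open>T' g\<close> to \<open>k\<close>. Surjectivity of
  \<open>T\<close> from \<open>K'\<close> onto \<open>M\<close>, which is
  \<open>kernel_exists\<close>, gives the direction from \<open>T' g \<in> K\<close> back to
  \<open>g\<close>.\<close>

lemma representation: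
  assumes inv: "\<And>x. x \<in> M \<Longrightarrow> (\<And>i. cf x (i, 0) = 0) \<Longrightarrow>
      \<exists>a\<in>M. \<exists>c. bwshift x = a + (\<Sum>j<p. c j *\<^sub>C e j)"
  obtains K where "closed K" "csubspace K" "K \<subseteq> hardy (r + p)" "fshift ` K \<subseteq> K"
    "\<And>g. g \<in> hardy m \<Longrightarrow> (\<forall>x\<in>M. cinner g x = 0) \<longleftrightarrow> T' g \<in> K"
proof -
  define K' where "K' = {k \<in> hardy (r + p). \<forall>n. T ((bwshift ^^ n) k) \<in> M}"
  define K where "K = hardy (r + p) \<inter> {g. \<forall>k\<in>K'. cinner g k = 0}"
  have K'_bwshift: "bwshift k \<in> K'" if "k \<in> K'" for k
  proof -
    have "T ((bwshift ^^ n) (bwshift k)) \<in> M" for n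
      using that funpow_Suc_right[of n bwshift] by (auto simp: K'_def simp del: funpow.simps dest: spec[of _ "Suc n"])
    then show ?thesis using that by (auto simp: K'_def bwshift_hardy)
  qed
  have "(\<forall>x\<in>M. cinner g x = 0) \<longleftrightarrow> T' g \<in> K" if g: "g \<in> hardy m" for g
  proof
    assume *: "\<forall>x\<in>M. cinner g x = 0"
    have "cinner (T' g) k = 0" if "k \<in> K'" for k
    proof -
      have "T k \<in> M" "k \<in> hardy (r + p)" using that funpow_0[of bwshift k] by (auto simp: K'_def dest: spec[of _ 0])
      then have "cinner k (T' g) = 0" using * adjoint[of k g] g cinner_eq_0_commute by metis
      then show ?thesis using cinner_eq_0_commute by blast
    qed
    then show "T' g \<in> K" using T'_hardy[OF g] by (simp add: K_def)
  next
    assume *: "T' g \<in> K"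
    show "\<forall>x\<in>M. cinner g x = 0"
    proof
      fix x assume "x \<in> M"
      obtain k where k: "k \<in> hardy (r + p)" "T k = x" "\<And>n. T ((bwshift ^^ n) k) \<in> M"
        using kernel_exists[OF inv \<open>x \<in> M\<close>] by blast
      then have "cinner (T' g) k = 0" using * by (auto simp: K_def K'_def)
      then have "cinner x g = 0" using adjoint[OF k(1) g] k(2) cinner_eq_0_commute by metis
      then show "cinner g x = 0" using cinner_eq_0_commute by blast
    qed
  qed
  moreover have "closed K" "csubspace K" unfolding K_def
    by (intro closed_Int csubspace_Int closed_hardy csubspace_hardy closed_csubspace_orthogonal)+
  moreover have "fshift ` K \<subseteq> K"
    using K'_bwshift by (auto simp: K_def fshift_hardy cinner_fshift)
  moreover have "K \<subseteq> hardy (r + p)" by (auto simp: K_def)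
  ultimately show thesis using that by blast
qed

text \<open>Since the \<open>e j\<close> are orthonormal and orthogonal to \<open>M\<close>, the
  only candidate for \<open>c\<close> consists of the Fourier coefficients of
  \<open>bwshift x\<close>. It remains to see that the rest \<open>a\<close> is orthogonal to every
  \<open>g\<close> that is orthogonal to \<open>M\<close>.\<close>

lemma bwshift_decomposition:
  assumes K: "closed K" "csubspace K" "K \<subseteq> hardy (r + p)" "fshift ` K \<subseteq> K"
    and rep: "\<And>g. g \<in> hardy m \<Longrightarrow> (\<forall>x\<in>M. cinner g x = 0) \<longleftrightarrow> T' g \<in> K"
    and x: "x \<in> M" "\<And>i. cf x (i, 0) = 0"
  shows "\<exists>a\<in>M. \<exists>c. bwshift x = a + (\<Sum>j<p. c j *\<^sub>C e j)"
proof -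
  define c where "c j = cinner (bwshift x) (e j)" for j
  define a where "a = bwshift x - (\<Sum>j<p. c j *\<^sub>C e j)"
  have a_e: "cinner a (e j) = 0" if "j < p" for j
    using that by (simp add: a_def c_def cinner_diff_left cinner_sum_e_e)
  define K' where "K' = {k \<in> hardy (r + p). \<forall>s\<in>K. cinner k s = 0}"
  have K'_bwshift: "bwshift k \<in> K'" if "k \<in> K'" for k
  proof -
    have "cinner (bwshift k) s = 0" if "s \<in> K" for s
    proof -
      have "cinner k (fshift s) = 0" using that \<open>k \<in> K'\<close> K(4) by (auto simp: K'_def)
      then have "cinner s (bwshift k) = 0" using cinner_eq_0_commute cinner_fshift by metis
      then show ?thesis using cinner_eq_0_commute by blast
    qed
    then show ?thesis using that by (auto simp: K'_def bwshift_hardy)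
  qed
  \<comment> \<open>A vector \<open>g\<close> orthogonal to \<open>M\<close> has \<open>T' g\<close>
    in \<open>K\<close>, hence orthogonal to \<open>k\<close>; so \<open>T k\<close> is orthogonal
    to all such \<open>g\<close>.\<close>
  have T_K': "T k \<in> M" if "k \<in> K'" for k
  proof (rule mem_if_orthogonal_to_orthogonal[OF M csubspace_hardy])
    have k: "k \<in> hardy (r + p)" using that by (simp add: K'_def)
    then show "T k \<in> hardy m" by (rule T_hardy)
    fix g assume g: "g \<in> hardy m" "\<And>s. s \<in> M \<Longrightarrow> cinner g s = 0"
    then have "T' g \<in> K" using rep by blast
    then show "cinner (T k) g = 0" using that adjoint[OF k g(1)] by (simp add: K'_def)
  qed
  have "a \<in> M"
  proof (rule mem_if_orthogonal_to_orthogonal[OF M csubspace_hardy])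
    show "a \<in> hardy m"
      using x M(3) bwshift_hardy sum_e_hardy csubspace_hardy by (auto simp: a_def intro!: csubspaceD(4))
    fix g assume g: "g \<in> hardy m" "\<And>s. s \<in> M \<Longrightarrow> cinner g s = 0"
    \<comment> \<open>Removing the components along the \<open>e j\<close> keeps orthogonality to
      \<open>M\<close> and changes nothing for \<open>a\<close>, which is orthogonal to the
      \<open>e j\<close> as well.\<close>
    define h where "h = g - (\<Sum>j<p. cinner g (e j) *\<^sub>C e j)"
    have h_hardy: "h \<in> hardy m" using g sum_e_hardy csubspace_hardy by (auto simp: h_def intro!: csubspaceD(4))
    have h_M: "cinner h s = 0" if "s \<in> M" for s
      using g(2)[OF that] cinner_sum_e[OF that] by (simp add: h_def cinner_diff_left)
    have h_e: "cinner (e j) h = 0" if "j < p" for j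
    proof -
      have "cinner h (e j) = 0"
        using that by (simp add: h_def cinner_diff_left cinner_sum_e_e)
      then show ?thesis using cinner_eq_0_commute by blast
    qed
    \<comment> \<open>The test vector: it is built so that both sums in \<open>T_rec\<close>
      disappear when \<open>T k\<close> is paired with it, the one over \<open>e j\<close> by the
      choice of \<open>h\<close> and the one over \<open>w j\<close> by subtracting
      \<open>w_part\<close>.\<close>
    define g' where "g' = fshift h - w_part (fshift h)"
    have g'_hardy: "g' \<in> hardy m"
      unfolding g'_def using fshift_hardy[OF h_hardy] w_part_mem M(3) csubspace_hardy by (auto intro: csubspaceD)
    have g'_w: "cinner (w j) g' = 0" if "j < r" for j
      using cinner_w_part[OF that, of "fshift h"] cinner_eq_0_commute by (auto simp: g'_def)
    have "T' g' \<in> K"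
    proof (rule mem_if_orthogonal_to_orthogonal[OF K(1-3) csubspace_hardy])
      show "T' g' \<in> hardy (r + p)" using g'_hardy by (rule T'_hardy)
      fix k assume "k \<in> hardy (r + p)" "\<And>s. s \<in> K \<Longrightarrow> cinner k s = 0"
      then have k: "k \<in> K'" "k \<in> hardy (r + p)" by (auto simp: K'_def)
      define b where "b = T (bwshift k) + (\<Sum>j<p. cf k (r + j, 0) *\<^sub>C e j)"
      have Tk: "T k = (\<Sum>j<r. cf k (j, 0) *\<^sub>C w j) + fshift b"
        unfolding b_def by (rule T_rec[OF k(2)])
      have "fshift b = T k - (\<Sum>j<r. cf k (j, 0) *\<^sub>C w j)" by (simp add: Tk)
      \<comment> \<open>So \<open>fshift b\<close> is an element of \<open>M\<close> vanishing at 0,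
        and therefore orthogonal to the \<open>w_part\<close> in \<open>g'\<close>.\<close>
      then have sb: "fshift b \<in> M" using T_K'[OF k(1)] sum_w_mem csubspaceD(4)[OF M(2)] by simp
      have "cinner (T (bwshift k)) h = 0"
        using h_M[OF T_K'[OF K'_bwshift[OF k(1)]]] cinner_eq_0_commute by blast
      then have "cinner b h = 0"
        by (simp add: b_def cinner_add_left cinner_sum_left h_e)
      then have "cinner (fshift b) (fshift h) = 0"
        by (simp add: cinner_fshift bwshift_fshift)
      moreover have "cinner (fshift b) (w_part (fshift h)) = 0"
      proof -
        have "cinner (w_part (fshift h)) (fshift b) = 0"
          unfolding w_part_def by (rule cinner_sum_w[OF sb]) (simp add: cf_fshift)
        then show ?thesis using cinner_eq_0_commute by blast
      qed
      ultimately have "cinner (T k) g' = 0"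
        unfolding Tk cinner_add_left by (simp add: cinner_sum_left g'_w) (simp add: g'_def cinner_diff_right)
      then have "cinner k (T' g') = 0" using adjoint[OF k(2) g'_hardy] by simp
      then show "cinner (T' g') k = 0" using cinner_eq_0_commute by blast
    qed
    \<comment> \<open>Here \<open>rep\<close> is read backwards: \<open>g'\<close> is orthogonal to
      \<open>M\<close>, in particular to \<open>x\<close>.\<close>
    then have "cinner g' x = 0" using rep[OF g'_hardy] x(1) by blast
    then have "cinner x g' = 0" using cinner_eq_0_commute by blast
    moreover have "cinner x (w_part (fshift h)) = 0"
    proof -
      have "cinner (w_part (fshift h)) x = 0" unfolding w_part_def by (rule cinner_sum_w[OF x])
      then show ?thesis using cinner_eq_0_commute by blast
    qed
    ultimately have "cinner x (fshift h) = 0" by (simp add: g'_def cinner_diff_right)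
    then have "cinner h (bwshift x) = 0" using cinner_fshift cinner_eq_0_commute by metis
    then have "cinner (bwshift x) h = 0" using cinner_eq_0_commute by blast
    then have "cinner a h = 0"
      by (simp add: a_def cinner_diff_left cinner_sum_left h_e)
    then show "cinner a g = 0"
      by (simp add: h_def cinner_diff_right cinner_sum_right a_e)
  qed
  then show ?thesis by (intro bexI[of _ a] exI[of _ c]) (simp_all add: a_def)
qed

end

section \<open>Matrices of multipliers\<close>

text \<open>The bound is demanded on every initial segment and for every formal series. For
  square-summable \<open>g\<close> it thus shows that the product is square summable, which is what
  gives \<open>mulop\<close> its meaning.\<close>

definition multiplier :: "complex fps \<Rightarrow> real \<Rightarrow> bool" where
  "multiplier f B \<longleftrightarrow> 0 \<le> B \<and> (\<forall>g L.
     (\<Sum>n<L. (cmod (fps_nth (f * g) n))\<^sup>2) \<le> B\<^sup>2 * (\<Sum>n<L. (cmod (fps_nth g n))\<^sup>2))"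

definition mulop :: "complex fps \<Rightarrow> nat ell2 \<Rightarrow> nat ell2" where
  "mulop f y = Abs_ell2 (fps_nth (f * Abs_fps (cf y)))"

context
  fixes f :: "complex fps" and B :: real
  assumes f: "multiplier f B"
begin

lemma multiplier_sum_le:
  assumes "finite A"
  shows "(\<Sum>n\<in>A. (cmod (fps_nth (f * Abs_fps (cf y)) n))\<^sup>2) \<le> (B * norm y)\<^sup>2"
proof -
  obtain L where "A \<subseteq> {..<L}" using assms finite_nat_iff_bounded by blast
  then have "(\<Sum>n\<in>A. (cmod (fps_nth (f * Abs_fps (cf y)) n))\<^sup>2)
      \<le> (\<Sum>n<L. (cmod (fps_nth (f * Abs_fps (cf y)) n))\<^sup>2)"
    by (intro sum_mono2) auto
  also have "\<dots> \<le> B\<^sup>2 * (\<Sum>n<L. (cmod (fps_nth (Abs_fps (cf y)) n))\<^sup>2)"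
    using f by (simp only: multiplier_def)
  also have "\<dots> \<le> B\<^sup>2 * (norm y)\<^sup>2"
    by (intro mult_left_mono) (simp_all add: sum_cf_le_norm)
  finally show ?thesis by (simp add: power_mult_distrib)
qed

lemma cf_mulop: "cf (mulop f y) n = fps_nth (f * Abs_fps (cf y)) n"
proof -
  have "(\<lambda>n. (cmod (fps_nth (f * Abs_fps (cf y)) n))\<^sup>2) summable_on UNIV"
    by (rule square_summable_if_bounded) (rule multiplier_sum_le)
  then show ?thesis by (simp add: mulop_def Abs_ell2_inverse)
qed

lemma norm_mulop_le: "norm (mulop f y) \<le> B * norm y"
  using f by (intro norm_le_if_sum_cf_le)
    (simp_all only: cf_mulop multiplier_sum_le multiplier_def norm_ge_zero mult_nonneg_nonneg)

end

text \<open>Applied to the argument of a multiplication operator, this yields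
  \<open>mat_op_rec\<close> and finally \<open>T_rec\<close>.\<close>

lemma Abs_fps_split:
  fixes a :: "nat \<Rightarrow> 'a::comm_ring_1"
  shows "Abs_fps a = fps_const (a 0) + fps_X * Abs_fps (\<lambda>n. a (Suc n))"
  by (rule fps_ext) (simp add: fps_X_mult_nth)

lemma cinner_hardy_ext:
  assumes "x \<in> hardy q" "y \<in> hardy q" "\<And>k. k \<in> hardy q \<Longrightarrow> cinner k x = cinner k y"
  shows "x = y"
proof -
  have "x - y \<in> hardy q" using assms csubspace_hardy by (auto intro: csubspaceD)
  then have "cinner (x - y) (x - y) = 0"
    using assms(3)[of "x - y"] by (simp add: cinner_diff_right)
  then have "x - y = 0" by (rule cinner_self_eq_0[THEN iffD1])
  then show ?thesis by simp
qed

text \<open>Multiplication by an m by q matrix of power series. Components of \<open>x\<close> from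
  \<open>q\<close> on are ignored, so the operator can later be applied to a longer vector and reads
  only its first block.\<close>

definition mat_op :: "nat \<Rightarrow> nat \<Rightarrow> (nat \<Rightarrow> nat \<Rightarrow> complex fps) \<Rightarrow> coeffs \<Rightarrow> coeffs" where
  "mat_op m q U x = (\<Sum>i<m. \<Sum>j<q. embed i (mulop (U i j) (component j x)))"

lemma norm_embed: "norm (embed i x) = norm x"
  by (simp add: embed_def norm_push inj_Pair)

lemma norm_component_le: "norm (component i x) \<le> norm x"
  by (simp add: component_def norm_pull_le)

lemma mat_op_hardy: "mat_op m q U x \<in> hardy m"
  by (auto simp: hardy_iff mat_op_def cf_embed)

context
  fixes m q :: nat and U :: "nat \<Rightarrow> nat \<Rightarrow> complex fps"
  assumes U: "\<And>i j. i < m \<Longrightarrow> j < q \<Longrightarrow> \<exists>B. multiplier (U i j) B"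
begin

lemma cf_mat_op:
  "cf (mat_op m q U x) (i, n) =
    (if i < m then \<Sum>j<q. fps_nth (U i j * Abs_fps (\<lambda>l. cf x (j, l))) n else 0)"
proof -
  have "cf (mat_op m q U x) (i, n) =
      (\<Sum>i'<m. if i' = i then \<Sum>j<q. cf (mulop (U i' j) (component j x)) n else 0)"
    unfolding mat_op_def cf_sum cf_embed by (intro sum.cong refl) simp
  also have "\<dots> = (if i < m then \<Sum>j<q. cf (mulop (U i j) (component j x)) n else 0)"
    by simp
  also have "\<dots> = (if i < m then \<Sum>j<q. fps_nth (U i j * Abs_fps (\<lambda>l. cf x (j, l))) n else 0)"
  proof (cases "i < m")
    case True
    have "cf (mulop (U i j) (component j x)) n = fps_nth (U i j * Abs_fps (\<lambda>l. cf x (j, l))) n"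
      if j: "j < q" for j
    proof -
      obtain B where "multiplier (U i j) B" using U[OF True j] by blast
      then show ?thesis by (simp add: cf_mulop fps_mult_nth)
    qed
    then show ?thesis by simp
  qed simp
  finally show ?thesis .
qed

lemma mat_op_add: "mat_op m q U (x + y) = mat_op m q U x + mat_op m q U y"
  by (rule ell2_eqI)
    (auto simp: cf_mat_op fps_mult_nth ring_distribs sum.distrib)

lemma mat_op_scaleC: "mat_op m q U (c *\<^sub>C x) = c *\<^sub>C mat_op m q U x"
  by (rule ell2_eqI)
    (auto simp: cf_mat_op fps_mult_nth sum_distrib_left mult_ac)

text \<open>The sum of all entry bounds is crude, but any constant serves for the Riesz
  theorem.\<close>

lemma mat_op_bounded: "\<exists>C. \<forall>x. norm (mat_op m q U x) \<le> C * norm x"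
proof -
  obtain B where B: "\<And>i j. i < m \<Longrightarrow> j < q \<Longrightarrow> multiplier (U i j) (B i j)"
    using U by metis
  have "norm (mat_op m q U x) \<le> (\<Sum>i<m. \<Sum>j<q. B i j) * norm x" for x
  proof -
    have "norm (embed i (mulop (U i j) (component j x))) \<le> B i j * norm x" if "i < m" "j < q" for i j
    proof -
      have "norm (mulop (U i j) (component j x)) \<le> B i j * norm (component j x)"
        by (rule norm_mulop_le[OF B[OF that]])
      also have "\<dots> \<le> B i j * norm x"
        using B[OF that] by (intro mult_left_mono norm_component_le) (simp add: multiplier_def)
      finally show ?thesis by (simp add: norm_embed)
    qed
    then have "norm (mat_op m q U x) \<le> (\<Sum>i<m. \<Sum>j<q. B i j * norm x)"
      unfolding mat_op_def by (intro order_trans[OF norm_sum] sum_mono) auto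
    then show ?thesis by (simp add: sum_distrib_right)
  qed
  then show ?thesis by blast
qed

text \<open>The Riesz vector lies in \<open>hardy q\<close> because the operator annihilates
  everything embedded in components from \<open>q\<close> on.\<close>

lemma mat_op_adjoint: "\<exists>y\<in>hardy q. \<forall>x. cinner (mat_op m q U x) g = cinner x y"
proof -
  obtain C where C: "\<And>x. norm (mat_op m q U x) \<le> C * norm x" using mat_op_bounded by blast
  obtain y where y: "\<And>x. cinner (mat_op m q U x) g = cinner x y"
  proof (rule cRiesz_representation[where f = "\<lambda>x. cinner (mat_op m q U x) g" and C = "C * norm g"])
    show "cmod (cinner (mat_op m q U x) g) \<le> C * norm g * norm x" for x
    proof -
      have "cmod (cinner (mat_op m q U x) g) \<le> norm (mat_op m q U x) * norm g"
        by (rule cmod_cinner_le)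
      also have "\<dots> \<le> C * norm x * norm g" by (intro mult_right_mono C) simp
      finally show ?thesis by (simp add: mult_ac)
    qed
  qed (simp_all add: mat_op_add mat_op_scaleC cinner_add_left)
  have "component i y = 0" if "q \<le> i" for i
  proof (rule cinner_ext)
    fix z
    have "mat_op m q U (embed i z) = 0"
      using that by (intro ell2_eqI) (auto simp: cf_mat_op cf_embed fps_mult_nth)
    then have "cinner (embed i z) y = 0" using y[of "embed i z"] by simp
    then show "cinner z (component i y) = 0" by (simp add: cinner_embed)
  qed
  then have "cf y (i, n) = 0" if "q \<le> i" for i n
    using that cf_component[of i y n] by simp
  then have "y \<in> hardy q" by (simp add: hardy_iff)
  then show ?thesis using y by blast
qed

lemma mat_op_rec:
  assumes w: "\<And>j i n. j < q \<Longrightarrow> cf (w j) (i, n) = (if i < m then fps_nth (U i j) n else 0)"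
  shows "mat_op m q U x = (\<Sum>j<q. cf x (j, 0) *\<^sub>C w j) + fshift (mat_op m q U (bwshift x))"
proof (rule ell2_eqI)
  fix a :: "nat \<times> nat"
  obtain i n where a: "a = (i, n)" by (cases a)
  show "cf (mat_op m q U x) a = cf ((\<Sum>j<q. cf x (j, 0) *\<^sub>C w j) + fshift (mat_op m q U (bwshift x))) a"
  proof (cases "i < m")
    case True
    have "fps_nth (U i j * Abs_fps (\<lambda>l. cf x (j, l))) n = cf x (j, 0) * fps_nth (U i j) n +
        (case n of 0 \<Rightarrow> 0 | Suc l \<Rightarrow> fps_nth (U i j * Abs_fps (\<lambda>l. cf (bwshift x) (j, l))) l)" for j
      by (subst Abs_fps_split)
        (simp add: distrib_left mult.left_commute[of "U i j"] fps_X_mult_nth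
          mult.commute[of "U i j" "fps_const _"] split: nat.split)
    then show ?thesis using True
      by (cases n) (simp_all add: a cf_mat_op cf_fshift w sum.distrib mult.commute)
  next
    case False
    then show ?thesis by (cases n) (simp_all add: a cf_mat_op cf_fshift w)
  qed
qed

end

section \<open>Functions on the disc and their Taylor coefficients\<close>

lemma vnorm_power2: "(vnorm v)\<^sup>2 = (\<Sum>i<dim_vec v. (cmod (v $ i))\<^sup>2)"
proof -
  have "Re (v \<bullet>c v) = (\<Sum>i<dim_vec v. (cmod (v $ i))\<^sup>2)"
    by (simp add: scalar_prod_def complex_norm_square[symmetric] atLeast0LessThan del: of_real_power)
  then show ?thesis by (simp add: vnorm_def sum_nonneg)
qed

lemma cmod_le_vnorm: "i < dim_vec v \<Longrightarrow> cmod (v $ i) \<le> vnorm v"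
proof (rule power2_le_imp_le)
  assume "i < dim_vec v"
  then show "(cmod (v $ i))\<^sup>2 \<le> (vnorm v)\<^sup>2"
    unfolding vnorm_power2 by (intro member_le_sum) auto
qed (simp add: vnorm_def scalar_prod_def sum_nonneg)

lemma H2D:
  fixes F :: vfun
  assumes "F \<in> H2 m"
  shows "F z \<in> carrier_vec m" "dim_vec (F z) = m" "z \<notin> ball 0 1 \<Longrightarrow> F z = 0\<^sub>v m"
    "i < m \<Longrightarrow> (\<lambda>z. F z $ i) holomorphic_on ball 0 1"
    "i < m \<Longrightarrow> (\<lambda>z. F z $ i) has_fps_expansion fps_expansion (\<lambda>z. F z $ i) 0"
proof -
  show "F z \<in> carrier_vec m" "z \<notin> ball 0 1 \<Longrightarrow> F z = 0\<^sub>v m"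
    using assms by (auto simp: H2_def)
  then show "dim_vec (F z) = m" by auto
  show hol: "(\<lambda>z. F z $ i) holomorphic_on ball 0 1" if "i < m" for i
    using assms that by (auto simp: H2_def)
  show "(\<lambda>z. F z $ i) has_fps_expansion fps_expansion (\<lambda>z. F z $ i) 0" if "i < m" for i
    using hol[OF that] by (intro has_fps_expansion_fps_expansion[of "ball 0 1"]) auto
qed

lemma taylor_coeff_index:
  "i < dim_vec (F 0) \<Longrightarrow> taylor_coeff F n $ i = fps_nth (fps_expansion (\<lambda>z. F z $ i) 0) n"
  by (simp add: taylor_coeff_def fps_expansion_def)

lemma vnorm_taylor_coeff:
  "(vnorm (taylor_coeff F n))\<^sup>2 =
    (\<Sum>i<dim_vec (F 0). (cmod (fps_nth (fps_expansion (\<lambda>z. F z $ i) 0) n))\<^sup>2)"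
  by (simp add: vnorm_power2 taylor_coeff_def fps_expansion_def)

text \<open>With \<open>fun_of\<close> as inverse this identifies \<open>H2 m\<close> with
  \<open>hardy m\<close>, preserving inner products. The inverse is exact because functions are zero
  outside the disc.\<close>

definition coeffs_of :: "nat \<Rightarrow> vfun \<Rightarrow> coeffs" where
  "coeffs_of m F = Abs_ell2 (\<lambda>(i, n). if i < m then fps_nth (fps_expansion (\<lambda>z. F z $ i) 0) n else 0)"

definition fun_of :: "nat \<Rightarrow> coeffs \<Rightarrow> vfun" where
  "fun_of m x = (\<lambda>z. if z \<in> ball 0 1
     then Matrix.vec m (\<lambda>i. eval_fps (Abs_fps (\<lambda>n. cf x (i, n))) z) else 0\<^sub>v m)"

lemma cf_coeffs_of:
  assumes "F \<in> H2 m"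
  shows "cf (coeffs_of m F) (i, n) = (if i < m then fps_nth (fps_expansion (\<lambda>z. F z $ i) 0) n else 0)"
proof -
  define f where "f = (\<lambda>(i, n). if i < m then fps_nth (fps_expansion (\<lambda>z. F z $ i) 0) n else 0)"
  have "(\<lambda>a. (cmod (f a))\<^sup>2) summable_on UNIV"
  proof (rule square_summable_if_bounded)
    fix A :: "(nat \<times> nat) set" assume "finite A"
    then obtain N where N: "snd ` A \<subseteq> {..<N}"
      using finite_nat_iff_bounded by blast
    have "(\<Sum>a\<in>A. (cmod (f a))\<^sup>2) = (\<Sum>a\<in>A \<inter> ({..<m} \<times> {..<N}). (cmod (f a))\<^sup>2)"
      using \<open>finite A\<close> N by (intro sum.mono_neutral_right) (auto simp: f_def split: if_splits)
    also have "\<dots> \<le> (\<Sum>a\<in>{..<m} \<times> {..<N}. (cmod (f a))\<^sup>2)"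
      by (intro sum_mono2) auto
    also have "\<dots> = (\<Sum>n<N. \<Sum>i<m. (cmod (f (i, n)))\<^sup>2)"
      by (subst sum.swap) (simp add: sum.cartesian_product)
    also have "\<dots> = (\<Sum>n<N. (vnorm (taylor_coeff F n))\<^sup>2)"
      unfolding vnorm_taylor_coeff H2D(2)[OF assms] by (simp add: f_def)
    also have "\<dots> \<le> (\<Sum>n. (vnorm (taylor_coeff F n))\<^sup>2)"
      using assms by (intro sum_le_suminf) (auto simp: H2_def)
    finally show "(\<Sum>a\<in>A. (cmod (f a))\<^sup>2) \<le> (\<Sum>n. (vnorm (taylor_coeff F n))\<^sup>2)" .
  qed
  then have "cf (Abs_ell2 f) = f" by (simp add: Abs_ell2_inverse)
  then show ?thesis by (simp add: coeffs_of_def f_def)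
qed

lemma coeffs_of_hardy: "F \<in> H2 m \<Longrightarrow> coeffs_of m F \<in> hardy m"
  by (simp add: hardy_iff cf_coeffs_of)

lemma summable_component: "summable (\<lambda>n. (cmod (cf (x :: coeffs) (i, n)))\<^sup>2)"
  using cf_summable[of "component i x"] by (intro summable_on_imp_summable) simp

text \<open>Used for every construction on functions: one guesses the coefficient family
  \<open>x\<close> and checks the local expansions; the summability demanded by \<open>H2\<close> is
  then inherited from \<open>x\<close>.\<close>

lemma H2I:
  fixes F :: vfun
  assumes "\<And>z. F z \<in> carrier_vec m" "\<And>z. z \<notin> ball 0 1 \<Longrightarrow> F z = 0\<^sub>v m"
    and "\<And>i. i < m \<Longrightarrow> (\<lambda>z. F z $ i) holomorphic_on ball 0 1"
    and x: "x \<in> hardy m" "\<And>i. i < m \<Longrightarrow> (\<lambda>z. F z $ i) has_fps_expansion Abs_fps (\<lambda>n. cf x (i, n))"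
  shows "F \<in> H2 m" "coeffs_of m F = x"
proof -
  have dim: "dim_vec (F 0) = m" using assms(1)[of 0] by simp
  have exp: "fps_expansion (\<lambda>z. F z $ i) 0 = Abs_fps (\<lambda>n. cf x (i, n))" if "i < m" for i
    by (rule fps_expansion_eqI[OF x(2)[OF that]])
  have "summable (\<lambda>n. (vnorm (taylor_coeff F n))\<^sup>2)"
    unfolding vnorm_taylor_coeff dim
    by (intro summable_sum) (simp add: exp summable_component)
  then show F: "F \<in> H2 m" using assms by (auto simp: H2_def)
  show "coeffs_of m F = x"
  proof (rule ell2_eqI)
    fix a :: "nat \<times> nat"
    obtain i n where "a = (i, n)" by (cases a)
    then show "cf (coeffs_of m F) a = cf x a"
      using x(1) by (auto simp: cf_coeffs_of[OF F] exp hardy_iff)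
  qed
qed

text \<open>All coefficients are bounded by \<open>norm x\<close>, so a geometric series dominates
  inside the unit disc.\<close>

lemma fps_conv_radius_cf: "fps_conv_radius (Abs_fps (\<lambda>n. cf x (i, n))) \<ge> 1"
  unfolding fps_conv_radius_def one_ereal_def
proof (rule conv_radius_geI_ex')
  fix r :: real assume r: "0 < r" "ereal r < ereal 1"
  have "summable (\<lambda>n. norm x * r ^ n)"
    using r by (intro summable_mult summable_geometric) simp
  then show "summable (\<lambda>n. fps_nth (Abs_fps (\<lambda>n. cf x (i, n))) n * of_real r ^ n)"
    using r by (elim summable_comparison_test')
      (auto simp: norm_mult norm_power intro!: mult_right_mono cmod_cf_le_norm)
qed

lemma fun_of_H2:
  assumes "x \<in> hardy m"
  shows "fun_of m x \<in> H2 m" "coeffs_of m (fun_of m x) = x"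
proof -
  have fps: "ball 0 1 \<subseteq> eball (0::complex) (fps_conv_radius (Abs_fps (\<lambda>n. cf x (i, n))))" for i
    by (rule ball_eball_mono) (simp add: fps_conv_radius_cf flip: one_ereal_def)
  have eq: "fun_of m x z $ i = eval_fps (Abs_fps (\<lambda>n. cf x (i, n))) z" if "i < m" "z \<in> ball 0 1" for z i
    using that by (simp add: fun_of_def)
  have hol: "(\<lambda>z. fun_of m x z $ i) holomorphic_on ball 0 1" if "i < m" for i
  proof -
    have "eval_fps (Abs_fps (\<lambda>n. cf x (i, n))) holomorphic_on ball 0 1"
      by (rule holomorphic_on_eval_fps[OF fps])
    then show ?thesis by (rule holomorphic_transform) (simp add: eq[OF that])
  qed
  have exp: "(\<lambda>z. fun_of m x z $ i) has_fps_expansion Abs_fps (\<lambda>n. cf x (i, n))" if "i < m" for i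
    unfolding has_fps_expansion_def
  proof
    show "0 < fps_conv_radius (Abs_fps (\<lambda>n. cf x (i, n)))"
      by (rule less_le_trans[OF _ fps_conv_radius_cf]) simp
    have "\<forall>\<^sub>F z in nhds 0. z \<in> ball (0::complex) 1" by (intro eventually_nhds_in_open) auto
    then show "\<forall>\<^sub>F z in nhds 0. eval_fps (Abs_fps (\<lambda>n. cf x (i, n))) z = fun_of m x z $ i"
      by eventually_elim (simp add: eq[OF that])
  qed
  show "fun_of m x \<in> H2 m" "coeffs_of m (fun_of m x) = x"
    by (rule H2I[OF _ _ hol assms exp]; simp add: fun_of_def)+
qed

lemma fun_of_coeffs_of:
  assumes "F \<in> H2 m" shows "fun_of m (coeffs_of m F) = F"
proof
  fix z
  show "fun_of m (coeffs_of m F) z = F z"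
  proof (cases "z \<in> ball 0 1")
    case True
    show ?thesis
    proof (rule eq_vecI)
      fix i assume "i < dim_vec (F z)"
      then have i: "i < m" using H2D(2)[OF assms] by simp
      have "Abs_fps (\<lambda>n. cf (coeffs_of m F) (i, n)) = fps_expansion (\<lambda>z. F z $ i) 0"
        using i by (intro fps_ext) (simp add: cf_coeffs_of[OF assms])
      then show "fun_of m (coeffs_of m F) z $ i = F z $ i"
        using True i has_fps_expansion_imp_eval_fps_eq[OF H2D(5)[OF assms i] _ H2D(4)[OF assms i], of z]
        by (simp add: fun_of_def)
    qed (use True in \<open>simp add: fun_of_def H2D(2)[OF assms]\<close>)
  qed (simp add: fun_of_def H2D(3)[OF assms])
qed

lemma coeffs_of_inject: "F \<in> H2 m \<Longrightarrow> G \<in> H2 m \<Longrightarrow> coeffs_of m F = coeffs_of m G \<longleftrightarrow> F = G"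
  by (metis fun_of_coeffs_of)

lemma fps_cf_coeffs_of:
  "F \<in> H2 m \<Longrightarrow> i < m \<Longrightarrow> Abs_fps (\<lambda>n. cf (coeffs_of m F) (i, n)) = fps_expansion (\<lambda>z. F z $ i) 0"
  by (rule fps_ext) (simp add: cf_coeffs_of)

section \<open>Linear operations and the shift in terms of coefficients\<close>

lemma H2_add:
  assumes "F \<in> H2 m" "G \<in> H2 m"
  shows "(\<lambda>z. F z + G z) \<in> H2 m" "coeffs_of m (\<lambda>z. F z + G z) = coeffs_of m F + coeffs_of m G"
proof -
  note [simp] = H2D(2)[OF assms(1)] H2D(2)[OF assms(2)]
  have exp: "(\<lambda>z. (F z + G z) $ i) has_fps_expansion Abs_fps (\<lambda>n. cf (coeffs_of m F + coeffs_of m G) (i, n))"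
    if "i < m" for i
  proof -
    have "(\<lambda>z. F z $ i + G z $ i) has_fps_expansion
        fps_expansion (\<lambda>z. F z $ i) 0 + fps_expansion (\<lambda>z. G z $ i) 0"
      by (rule has_fps_expansion_add[OF H2D(5)[OF assms(1) that] H2D(5)[OF assms(2) that]])
    also have "\<dots> = Abs_fps (\<lambda>n. cf (coeffs_of m F + coeffs_of m G) (i, n))"
      using that by (intro fps_ext) (simp add: cf_coeffs_of assms)
    finally show ?thesis using that by simp
  qed
  have hol: "(\<lambda>z. (F z + G z) $ i) holomorphic_on ball 0 1" if "i < m" for i
    using holomorphic_on_add[OF H2D(4)[OF assms(1) that] H2D(4)[OF assms(2) that]] that by simp
  show "(\<lambda>z. F z + G z) \<in> H2 m" "coeffs_of m (\<lambda>z. F z + G z) = coeffs_of m F + coeffs_of m G"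
    by (rule H2I[OF _ _ hol _ exp];
        simp add: H2D(1,3)[OF assms(1)] H2D(1,3)[OF assms(2)] csubspaceD(2)[OF csubspace_hardy] coeffs_of_hardy assms)+
qed

lemma smult_zero_vec_complex: "(c :: complex) \<cdot>\<^sub>v 0\<^sub>v m = 0\<^sub>v m"
  by (rule eq_vecI) simp_all

lemma H2_smult:
  assumes "F \<in> H2 m"
  shows "(\<lambda>z. c \<cdot>\<^sub>v F z) \<in> H2 m" "coeffs_of m (\<lambda>z. c \<cdot>\<^sub>v F z) = c *\<^sub>C coeffs_of m F"
proof -
  note [simp] = H2D(2)[OF assms(1)]
  have exp: "(\<lambda>z. (c \<cdot>\<^sub>v F z) $ i) has_fps_expansion Abs_fps (\<lambda>n. cf (c *\<^sub>C coeffs_of m F) (i, n))"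
    if "i < m" for i
  proof -
    have "(\<lambda>z. c * F z $ i) has_fps_expansion fps_const c * fps_expansion (\<lambda>z. F z $ i) 0"
      by (rule has_fps_expansion_cmult_left[OF H2D(5)[OF assms that]])
    also have "\<dots> = Abs_fps (\<lambda>n. cf (c *\<^sub>C coeffs_of m F) (i, n))"
      using that by (intro fps_ext) (simp add: cf_coeffs_of assms)
    finally show ?thesis using that by simp
  qed
  have hol: "(\<lambda>z. (c \<cdot>\<^sub>v F z) $ i) holomorphic_on ball 0 1" if "i < m" for i
    using holomorphic_on_mult[OF holomorphic_on_const H2D(4)[OF assms that]] that by simp
  show "(\<lambda>z. c \<cdot>\<^sub>v F z) \<in> H2 m" "coeffs_of m (\<lambda>z. c \<cdot>\<^sub>v F z) = c *\<^sub>C coeffs_of m F"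
    by (rule H2I[OF _ _ hol _ exp];
        simp add: H2D(1,3)[OF assms(1)] smult_zero_vec_complex csubspaceD(3)[OF csubspace_hardy] coeffs_of_hardy assms)+
qed

lemma H2_diff:
  assumes "F \<in> H2 m" "G \<in> H2 m"
  shows "(\<lambda>z. F z - G z) \<in> H2 m" "coeffs_of m (\<lambda>z. F z - G z) = coeffs_of m F - coeffs_of m G"
proof -
  have eq: "(\<lambda>z. F z - G z) = (\<lambda>z. F z + (- 1) \<cdot>\<^sub>v G z)"
    by (rule ext, rule eq_vecI) (simp_all add: H2D(2)[OF assms(1)] H2D(2)[OF assms(2)])
  show "(\<lambda>z. F z - G z) \<in> H2 m" unfolding eq by (intro H2_add H2_smult assms)
  show "coeffs_of m (\<lambda>z. F z - G z) = coeffs_of m F - coeffs_of m G"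
    unfolding eq by (rule ell2_eqI) (simp add: H2_add H2_smult assms)
qed

lemma H2_zero: "(\<lambda>z. 0\<^sub>v m) \<in> H2 m" "coeffs_of m (\<lambda>z. 0\<^sub>v m) = 0"
proof -
  have hol: "(\<lambda>z. 0\<^sub>v m $ i) holomorphic_on ball 0 1" for i by simp
  have exp: "(\<lambda>z. 0\<^sub>v m $ i) has_fps_expansion Abs_fps (\<lambda>n. cf 0 (i, n))" if "i < m" for i
    using that by (simp add: fps_zero_def[symmetric])
  show "(\<lambda>z. 0\<^sub>v m) \<in> H2 m" "coeffs_of m (\<lambda>z. 0\<^sub>v m) = 0"
    by (rule H2I[OF _ _ hol _ exp]; simp add: hardy_iff)+
qed

lemma H2_shift:
  assumes "F \<in> H2 m"
  shows "shift F \<in> H2 m" "coeffs_of m (shift F) = fshift (coeffs_of m F)"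
proof -
  note [simp] = H2D(2)[OF assms(1)]
  have exp: "(\<lambda>z. shift F z $ i) has_fps_expansion Abs_fps (\<lambda>n. cf (fshift (coeffs_of m F)) (i, n))"
    if "i < m" for i
  proof -
    have "(\<lambda>z. z * F z $ i) has_fps_expansion fps_X * fps_expansion (\<lambda>z. F z $ i) 0"
      by (rule has_fps_expansion_mult[OF has_fps_expansion_fps_X H2D(5)[OF assms that]])
    also have "\<dots> = Abs_fps (\<lambda>n. cf (fshift (coeffs_of m F)) (i, n))"
      using that by (intro fps_ext) (simp add: cf_coeffs_of assms cf_fshift fps_X_mult_nth split: nat.split)
    finally show ?thesis using that by (simp add: shift_def)
  qed
  have hol: "(\<lambda>z. shift F z $ i) holomorphic_on ball 0 1" if "i < m" for i
    using holomorphic_on_mult[OF holomorphic_on_ident H2D(4)[OF assms that]] that by (simp add: shift_def)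
  show "shift F \<in> H2 m" "coeffs_of m (shift F) = fshift (coeffs_of m F)"
    by (rule H2I[OF _ _ hol _ exp];
        simp add: shift_def H2D(1,3)[OF assms(1)] smult_zero_vec_complex fshift_hardy coeffs_of_hardy assms)+
qed

lemma lincomb_0: "lincomb m 0 c B = (\<lambda>z. 0\<^sub>v m)"
  by (rule ext, rule eq_vecI) (simp_all add: lincomb_def)

lemma lincomb_Suc:
  "B n \<in> H2 m \<Longrightarrow> lincomb m (Suc n) c B = (\<lambda>z. lincomb m n c B z + c n \<cdot>\<^sub>v B n z)"
  using H2D(2)[of "B n" m] by (intro ext eq_vecI) (simp_all add: lincomb_def)

lemma H2_lincomb:
  assumes "\<And>j. j < n \<Longrightarrow> B j \<in> H2 m"
  shows "lincomb m n c B \<in> H2 m" "coeffs_of m (lincomb m n c B) = (\<Sum>j<n. c j *\<^sub>C coeffs_of m (B j))"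
  using assms
  by (induction n) (simp_all add: lincomb_0 lincomb_Suc H2_zero H2_add H2_smult)

lemma cinner_sums:
  assumes "F \<in> H2 m" "G \<in> H2 m"
  shows "(\<lambda>n. taylor_coeff F n \<bullet>c taylor_coeff G n) sums cinner (coeffs_of m F) (coeffs_of m G)"
proof -
  have "(\<lambda>n. cf (component i x) n * cnj (cf (component i y) n)) sums cinner (component i x) (component i y)"
    for x y :: coeffs and i
    unfolding cinner_def by (intro has_sum_imp_sums has_sum_infsum cinner_summable)
  then have "(\<lambda>n. \<Sum>i<m. cf (coeffs_of m F) (i, n) * cnj (cf (coeffs_of m G) (i, n)))
      sums cinner (coeffs_of m F) (coeffs_of m G)"
    unfolding cinner_hardy[OF coeffs_of_hardy[OF assms(1)]] by (intro sums_sum) simp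
  moreover have "(\<Sum>i<m. cf (coeffs_of m F) (i, n) * cnj (cf (coeffs_of m G) (i, n))) =
      taylor_coeff F n \<bullet>c taylor_coeff G n" for n
  proof -
    have "dim_vec (taylor_coeff F n) = m" "dim_vec (taylor_coeff G n) = m"
      using assms by (simp_all add: taylor_coeff_def H2D(2))
    then show ?thesis
      by (simp add: scalar_prod_def atLeast0LessThan cf_coeffs_of assms taylor_coeff_index
          H2D(2)[OF assms(1)] H2D(2)[OF assms(2)])
  qed
  ultimately show ?thesis by simp
qed

lemma H2_inner_eq_cinner:
  "F \<in> H2 m \<Longrightarrow> G \<in> H2 m \<Longrightarrow> H2_inner F G = cinner (coeffs_of m F) (coeffs_of m G)"
  unfolding H2_inner_def by (rule sums_unique[symmetric]) (rule cinner_sums)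

lemma H2_norm_eq_norm:
  assumes "F \<in> H2 m" shows "H2_norm F = norm (coeffs_of m F)"
proof -
  have "(\<lambda>n. Re (taylor_coeff F n \<bullet>c taylor_coeff F n)) sums Re (cinner (coeffs_of m F) (coeffs_of m F))"
    by (rule sums_Re[OF cinner_sums[OF assms assms]])
  moreover have "Re (v \<bullet>c v) = (vnorm v)\<^sup>2" for v
    by (simp add: vnorm_def scalar_prod_def sum_nonneg)
  ultimately have "(\<lambda>n. (vnorm (taylor_coeff F n))\<^sup>2) sums (norm (coeffs_of m F))\<^sup>2"
    by (simp add: power2_norm_eq_cinner)
  then show ?thesis by (simp add: H2_norm_def sums_unique[symmetric])
qed

section \<open>Closed subspaces of functions and of coefficient families\<close>

lemma coeffs_of_closed_subspace:
  assumes "H2_closed_subspace m S"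
  shows "S \<subseteq> H2 m" "closed (coeffs_of m ` S)" "csubspace (coeffs_of m ` S)" "coeffs_of m ` S \<subseteq> hardy m"
proof -
  have S: "S \<subseteq> H2 m" "(\<lambda>z. 0\<^sub>v m) \<in> S"
    "\<And>F G. F \<in> S \<Longrightarrow> G \<in> S \<Longrightarrow> (\<lambda>z. F z + G z) \<in> S" "\<And>F c. F \<in> S \<Longrightarrow> (\<lambda>z. c \<cdot>\<^sub>v F z) \<in> S"
    using assms by (auto simp: H2_closed_subspace_def H2_subspace_def)
  have lim: "F \<in> S" if "\<And>n. X n \<in> S" "F \<in> H2 m" "(\<lambda>n. H2_norm (\<lambda>z. X n z - F z)) \<longlonglongrightarrow> 0" for X F
    using assms that unfolding H2_closed_subspace_def by blast
  show "S \<subseteq> H2 m" by fact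
  show hardy: "coeffs_of m ` S \<subseteq> hardy m" using S(1) coeffs_of_hardy by blast
  show "csubspace (coeffs_of m ` S)" unfolding csubspace_def
  proof (intro conjI ballI allI)
    show "0 \<in> coeffs_of m ` S"
      using imageI[OF S(2), of "coeffs_of m"] by (simp only: H2_zero(2))
    fix x assume "x \<in> coeffs_of m ` S"
    then obtain F where F: "F \<in> S" "x = coeffs_of m F" by blast
    have F_H2: "F \<in> H2 m" using F(1) S(1) by blast
    show "c *\<^sub>C x \<in> coeffs_of m ` S" for c
      using imageI[OF S(4)[OF F(1), of c], of "coeffs_of m"] by (simp only: H2_smult(2)[OF F_H2] F(2))
    fix y assume "y \<in> coeffs_of m ` S"
    then obtain G where G: "G \<in> S" "y = coeffs_of m G" by blast
    have G_H2: "G \<in> H2 m" using G(1) S(1) by blast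
    show "x + y \<in> coeffs_of m ` S"
      using imageI[OF S(3)[OF F(1) G(1)], of "coeffs_of m"]
      by (simp only: H2_add(2)[OF F_H2 G_H2] F(2) G(2))
  qed
  show "closed (coeffs_of m ` S)"
    unfolding closed_sequential_limits
  proof (intro allI impI, elim conjE)
    fix Y y assume Y: "\<forall>n. Y n \<in> coeffs_of m ` S" and lim_y: "Y \<longlonglongrightarrow> y"
    obtain X where X: "\<And>n. X n \<in> S" "\<And>n. Y n = coeffs_of m (X n)" using Y unfolding image_iff by metis
    have y: "y \<in> hardy m"
      using closed_sequentially[OF closed_hardy _ lim_y] Y hardy by blast
    have "H2_norm (\<lambda>z. X n z - fun_of m y z) = norm (Y n - y)" for n
      using X(1)[of n] S(1) fun_of_H2[OF y] by (simp add: H2_norm_eq_norm[of _ m] H2_diff X(2) subset_iff)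
    then have "fun_of m y \<in> S"
      using lim[of X, OF X(1) fun_of_H2(1)[OF y]] lim_y by (simp add: LIM_zero tendsto_norm_zero)
    then have "coeffs_of m (fun_of m y) \<in> coeffs_of m ` S" by (rule imageI)
    then show "y \<in> coeffs_of m ` S" by (simp only: fun_of_H2(2)[OF y])
  qed
qed

lemma H2_closed_subspaceI:
  assumes "closed K" "csubspace K"
  shows "H2_closed_subspace q {F \<in> H2 q. coeffs_of q F \<in> K}"
  unfolding H2_closed_subspace_def H2_subspace_def
proof (intro conjI ballI allI impI)
  fix X F assume "(\<forall>n. X n \<in> {F \<in> H2 q. coeffs_of q F \<in> K}) \<and> F \<in> H2 q \<and>
    (\<lambda>n. H2_norm (\<lambda>z. X n z - F z)) \<longlonglongrightarrow> 0"
  then have X: "\<And>n. X n \<in> H2 q" "\<And>n. coeffs_of q (X n) \<in> K" and F: "F \<in> H2 q"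
    and lim: "(\<lambda>n. H2_norm (\<lambda>z. X n z - F z)) \<longlonglongrightarrow> 0" by auto
  have "(\<lambda>n. norm (coeffs_of q (X n) - coeffs_of q F)) \<longlonglongrightarrow> 0"
    using lim by (simp add: H2_norm_eq_norm[of _ q] H2_diff X(1) F)
  then have "(\<lambda>n. coeffs_of q (X n)) \<longlonglongrightarrow> coeffs_of q F"
    by (simp add: LIM_zero_iff tendsto_norm_zero_iff)
  then have "coeffs_of q F \<in> K" by (rule closed_sequentially[OF assms(1) X(2)])
  then show "F \<in> {F \<in> H2 q. coeffs_of q F \<in> K}" using F by simp
qed (use assms(2) in \<open>auto simp: H2_zero H2_add H2_smult csubspaceD\<close>)

section \<open>Adjoints of multiplication operators\<close>

text \<open>\<open>adjoint_op\<close> is a definite description. Existence is supplied by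
  \<open>y\<close>, and uniqueness holds because an element of \<open>hardy k\<close> is determined
  by its products with \<open>hardy k\<close>.\<close>

lemma adjoint_op_eq:
  assumes T: "\<And>K. K \<in> H2 k \<Longrightarrow> T K \<in> H2 m" "\<And>K. K \<in> H2 k \<Longrightarrow> coeffs_of m (T K) = A (coeffs_of k K)"
    and y: "y \<in> hardy k" "\<And>x. x \<in> hardy k \<Longrightarrow> cinner (A x) (coeffs_of m G) = cinner x y"
    and G: "G \<in> H2 m"
  shows "adjoint_op k T G \<in> H2 k" "coeffs_of k (adjoint_op k T G) = y"
proof -
  have "adjoint_op k T G = fun_of k y"
    unfolding adjoint_op_def
  proof (rule the_equality)
    have "H2_inner (T K) G = H2_inner K (fun_of k y)" if "K \<in> H2 k" for K
      using that G T y(2)[OF coeffs_of_hardy[OF that]] fun_of_H2[OF y(1)]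
      by (simp add: H2_inner_eq_cinner[of _ m] H2_inner_eq_cinner[of _ k])
    then show "fun_of k y \<in> H2 k \<and> (\<forall>K\<in>H2 k. H2_inner (T K) G = H2_inner K (fun_of k y))"
      using fun_of_H2[OF y(1)] by blast
  next
    fix H assume H: "H \<in> H2 k \<and> (\<forall>K\<in>H2 k. H2_inner (T K) G = H2_inner K H)"
    have "coeffs_of k H = y"
    proof (rule cinner_hardy_ext)
      fix x assume x: "x \<in> hardy k"
      have "H2_inner (T (fun_of k x)) G = H2_inner (fun_of k x) H"
        using H fun_of_H2(1)[OF x] by blast
      then have "cinner (A x) (coeffs_of m G) = cinner x (coeffs_of k H)"
        using H G T fun_of_H2[OF x] by (simp add: H2_inner_eq_cinner[of _ m] H2_inner_eq_cinner[of _ k])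
      then show "cinner x (coeffs_of k H) = cinner x y" using y(2)[OF x] by simp
    qed (use H y in \<open>simp_all add: coeffs_of_hardy\<close>)
    then show "H = fun_of k y" using fun_of_coeffs_of[of H k] H by simp
  qed
  then show "adjoint_op k T G \<in> H2 k" "coeffs_of k (adjoint_op k T G) = y"
    using fun_of_H2[OF y(1)] by simp_all
qed

lemma bshift_H2:
  assumes "G \<in> H2 m"
  shows "bshift m G \<in> H2 m" "coeffs_of m (bshift m G) = bwshift (coeffs_of m G)"
  unfolding bshift_def
  by (rule adjoint_op_eq[where A = fshift and m = m];
      simp add: H2_shift bwshift_hardy coeffs_of_hardy cinner_fshift assms)+

definition expansions :: "(nat \<Rightarrow> vfun) \<Rightarrow> nat \<Rightarrow> nat \<Rightarrow> complex fps" where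
  "expansions W i j = fps_expansion (\<lambda>z. W j z $ i) 0"

text \<open>Each entry of a bounded vector function is bounded by its vector norm, so
  \<open>multiplier_bound\<close> applies entry by entry.\<close>

lemma multiplier_expansions:
  assumes "W j \<in> H2 m" "bounded_on_disc (W j)" "i < m"
  shows "\<exists>B. multiplier (expansions W i j) B"
proof -
  obtain B where B: "\<And>z. z \<in> ball 0 1 \<Longrightarrow> vnorm (W j z) \<le> B"
    using assms(2) unfolding bounded_on_disc_def by blast
  have "cmod (W j z $ i) \<le> B" if "z \<in> ball 0 1" for z
    using cmod_le_vnorm[of i "W j z"] B[OF that] assms(3) H2D(2)[OF assms(1)] by simp
  then have "(\<Sum>n<L. (cmod (fps_nth (expansions W i j * g) n))\<^sup>2) \<le> B\<^sup>2 * (\<Sum>n<L. (cmod (fps_nth g n))\<^sup>2)"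
    for g L
    unfolding expansions_def by (rule multiplier_bound[OF H2D(4)[OF assms(1,3)]])
  moreover have "0 \<le> B" using order_trans[OF norm_ge_zero \<open>\<And>z. z \<in> ball 0 1 \<Longrightarrow> cmod (W j z $ i) \<le> B\<close>[of 0]] by simp
  ultimately show ?thesis unfolding multiplier_def by blast
qed

lemma cols_fun_mult_index:
  assumes "K \<in> H2 q" "i < m"
  shows "mult_op (cols_fun m q W) K z $ i = (\<Sum>j<q. W j z $ i * K z $ j)"
proof -
  have "mult_op (cols_fun m q W) K z $ i = Matrix.row (mat_of_cols m (map (\<lambda>j. W j z) [0..<q])) i \<bullet> K z"
    using assms(2) by (simp add: mult_op_def cols_fun_def)
  also have "\<dots> = (\<Sum>j<q. W j z $ i * K z $ j)"
    unfolding scalar_prod_def H2D(2)[OF assms(1)] atLeast0LessThan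
    using assms(2) by (intro sum.cong refl) (simp add: mat_of_cols_def)
  finally show ?thesis .
qed

lemma mult_op_H2:
  assumes W: "\<And>j. j < q \<Longrightarrow> W j \<in> H2 m" "\<And>j. j < q \<Longrightarrow> bounded_on_disc (W j)" and K: "K \<in> H2 q"
  shows "mult_op (cols_fun m q W) K \<in> H2 m"
    "coeffs_of m (mult_op (cols_fun m q W) K) = mat_op m q (expansions W) (coeffs_of q K)"
proof -
  note index = cols_fun_mult_index[OF K]
  have mult: "\<exists>B. multiplier (expansions W i j) B" if "i < m" "j < q" for i j
    by (rule multiplier_expansions[where W = W, OF W(1)[OF that(2)] W(2)[OF that(2)] that(1)])
  have carrier: "mult_op (cols_fun m q W) K z \<in> carrier_vec m" for z
    by (simp add: mult_op_def cols_fun_def carrier_vecI)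
  have zero: "mult_op (cols_fun m q W) K z = 0\<^sub>v m" if "z \<notin> ball 0 1" for z
    using carrier[of z] by (intro eq_vecI) (auto simp: index H2D(3)[OF K that])
  have hol: "(\<lambda>z. mult_op (cols_fun m q W) K z $ i) holomorphic_on ball 0 1" if "i < m" for i
    unfolding index[OF that]
    by (intro holomorphic_on_sum holomorphic_on_mult H2D(4)[OF K] H2D(4)[OF W(1)] that) auto
  have exp: "(\<lambda>z. mult_op (cols_fun m q W) K z $ i) has_fps_expansion
      Abs_fps (\<lambda>n. cf (mat_op m q (expansions W) (coeffs_of q K)) (i, n))" if "i < m" for i
  proof -
    have "(\<lambda>z. \<Sum>j<q. W j z $ i * K z $ j) has_fps_expansion
        (\<Sum>j<q. expansions W i j * fps_expansion (\<lambda>z. K z $ j) 0)"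
      unfolding expansions_def
      by (intro has_fps_expansion_sum has_fps_expansion_mult H2D(5)[OF K] H2D(5)[OF W(1)] that) auto
    also have "\<dots> = Abs_fps (\<lambda>n. cf (mat_op m q (expansions W) (coeffs_of q K)) (i, n))"
    proof (rule fps_ext)
      fix n
      have "cf (mat_op m q (expansions W) (coeffs_of q K)) (i, n) =
          (\<Sum>j<q. fps_nth (expansions W i j * Abs_fps (\<lambda>l. cf (coeffs_of q K) (j, l))) n)"
        using that by (subst cf_mat_op[OF mult]) simp_all
      also have "\<dots> = (\<Sum>j<q. fps_nth (expansions W i j * fps_expansion (\<lambda>z. K z $ j) 0) n)"
        by (intro sum.cong refl) (simp add: fps_cf_coeffs_of[OF K])
      finally show "fps_nth (\<Sum>j<q. expansions W i j * fps_expansion (\<lambda>z. K z $ j) 0) n =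
          fps_nth (Abs_fps (\<lambda>n. cf (mat_op m q (expansions W) (coeffs_of q K)) (i, n))) n"
        by (simp add: fps_sum_nth)
    qed
    finally show ?thesis unfolding index[OF that] .
  qed
  show "mult_op (cols_fun m q W) K \<in> H2 m"
    "coeffs_of m (mult_op (cols_fun m q W) K) = mat_op m q (expansions W) (coeffs_of q K)"
    by (rule H2I[where F = "mult_op (cols_fun m q W) K", OF carrier zero hol mat_op_hardy exp]; assumption)+
qed

lemma adjoint_mult_op:
  assumes W: "\<And>j. j < q \<Longrightarrow> W j \<in> H2 m" "\<And>j. j < q \<Longrightarrow> bounded_on_disc (W j)" and G: "G \<in> H2 m"
  shows "adjoint_op q (mult_op (cols_fun m q W)) G \<in> H2 q"
    "cinner (mat_op m q (expansions W) x) (coeffs_of m G) =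
      cinner x (coeffs_of q (adjoint_op q (mult_op (cols_fun m q W)) G))"
proof -
  have mult: "\<exists>B. multiplier (expansions W i j) B" if "i < m" "j < q" for i j
    by (rule multiplier_expansions[where W = W, OF W(1)[OF that(2)] W(2)[OF that(2)] that(1)])
  obtain y where y: "y \<in> hardy q" "\<And>x. cinner (mat_op m q (expansions W) x) (coeffs_of m G) = cinner x y"
    using mat_op_adjoint[where m = m and q = q and U = "expansions W" and g = "coeffs_of m G", OF mult] by blast
  note adj = adjoint_op_eq[where T = "mult_op (cols_fun m q W)" and A = "mat_op m q (expansions W)",
      OF mult_op_H2[where W = W and q = q, OF W] y G]
  show "adjoint_op q (mult_op (cols_fun m q W)) G \<in> H2 q" by (rule adj)
  show "cinner (mat_op m q (expansions W) x) (coeffs_of m G) =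
      cinner x (coeffs_of q (adjoint_op q (mult_op (cols_fun m q W)) G))"
    using y(2) by (simp only: adj(2))
qed

lemma cinner_embed_right: "cinner x (embed i y) = cinner (component i x) y"
  by (metis cinner_commute cinner_embed)

text \<open>
  In function notation, \<open>synthesis\<close> maps \<open>(k\<^sub>0, k\<^sub>1, \<dots>, k\<^sub>p)\<close> to
  \<open>F\<^sub>0 k\<^sub>0 + z (E\<^sub>1 k\<^sub>1 + \<dots> + E\<^sub>p k\<^sub>p)\<close>.
\<close>

definition synthesis ::
  "nat \<Rightarrow> nat \<Rightarrow> nat \<Rightarrow> (nat \<Rightarrow> vfun) \<Rightarrow> (nat \<Rightarrow> vfun) \<Rightarrow> coeffs \<Rightarrow> coeffs" where
  "synthesis m r p W E k = mat_op m r (expansions W) k +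
    (\<Sum>j<p. fshift (mat_op m 1 (expansions (\<lambda>_. E j)) (embed 0 (component (r + j) k))))"

context
  fixes m r p :: nat and W E :: "nat \<Rightarrow> vfun"
  assumes W: "\<And>j. j < r \<Longrightarrow> W j \<in> H2 m" "\<And>j. j < r \<Longrightarrow> bounded_on_disc (W j)"
    and E: "\<And>j. j < p \<Longrightarrow> E j \<in> H2 m" "\<And>j. j < p \<Longrightarrow> bounded_on_disc (E j)"
begin

lemma synthesis_hardy: "synthesis m r p W E k \<in> hardy m"
  unfolding synthesis_def
  by (intro csubspaceD(2)[OF csubspace_hardy] csubspace_sum[OF csubspace_hardy] mat_op_hardy fshift_hardy)

text \<open>This becomes \<open>T_rec\<close>. The constant terms of the \<open>E\<close>-blocks
  stand inside \<open>fshift\<close>, unlike those of the \<open>W\<close>-block, because these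
  blocks carry an extra factor z.\<close>

lemma synthesis_rec:
  "synthesis m r p W E k = (\<Sum>j<r. cf k (j, 0) *\<^sub>C coeffs_of m (W j)) +
    fshift (synthesis m r p W E (bwshift k) + (\<Sum>j<p. cf k (r + j, 0) *\<^sub>C coeffs_of m (E j)))"
proof -
  have "mat_op m r (expansions W) k = (\<Sum>j<r. cf k (j, 0) *\<^sub>C coeffs_of m (W j)) +
      fshift (mat_op m r (expansions W) (bwshift k))"
  proof (rule mat_op_rec)
    show "\<exists>B. multiplier (expansions W i j) B" if "i < m" "j < r" for i j
      by (rule multiplier_expansions[where W = W, OF W(1)[OF that(2)] W(2)[OF that(2)] that(1)])
  qed (simp add: cf_coeffs_of[OF W(1)] expansions_def)
  moreover have "mat_op m 1 (expansions (\<lambda>_. E j)) (embed 0 (component (r + j) k)) =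
      cf k (r + j, 0) *\<^sub>C coeffs_of m (E j) +
      fshift (mat_op m 1 (expansions (\<lambda>_. E j)) (embed 0 (component (r + j) (bwshift k))))"
    if j: "j < p" for j
  proof -
    have "mat_op m 1 (expansions (\<lambda>_. E j)) (embed 0 (component (r + j) k)) =
        (\<Sum>l<1. cf (embed 0 (component (r + j) k)) (l, 0) *\<^sub>C coeffs_of m (E j)) +
        fshift (mat_op m 1 (expansions (\<lambda>_. E j)) (bwshift (embed 0 (component (r + j) k))))"
    proof (rule mat_op_rec)
      show "\<exists>B. multiplier (expansions (\<lambda>_. E j) i l) B" if "i < m" "l < 1" for i l
        by (rule multiplier_expansions[where W = "\<lambda>_. E j", OF E(1)[OF j] E(2)[OF j] that(1)])
    qed (simp add: cf_coeffs_of[OF E(1)[OF j]] expansions_def)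
    moreover have "bwshift (embed 0 (component (r + j) k)) = embed 0 (component (r + j) (bwshift k))"
      by (rule ell2_eqI) (auto simp: cf_embed)
    ultimately show ?thesis by (simp add: cf_embed)
  qed
  ultimately show ?thesis
    by (simp add: synthesis_def fshift_add fshift_sum sum.distrib)
qed

text \<open>The extra factor z in front of the \<open>E\<close>-blocks of \<open>synthesis\<close>
  turns into the backward shift under the adjoint; this is why \<open>full_sum\<close> applies it to
  \<open>G\<close> in those blocks only.\<close>

lemma full_sum_adjoint:
  assumes G: "G \<in> H2 m"
  shows "full_sum m r p W E G \<in> H2 (r + p)"
    "cinner (synthesis m r p W E k) (coeffs_of m G) = cinner k (coeffs_of (r + p) (full_sum m r p W E G))"
proof -
  define a where "a = adjoint_op r (mult_op (cols_fun m r W)) G"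
  define b where "b j = adjoint_op 1 (mult_op (cols_fun m 1 (\<lambda>_. E j))) (bshift m G)" for j
  have a: "a \<in> H2 r"
    "\<And>x. cinner (mat_op m r (expansions W) x) (coeffs_of m G) = cinner x (coeffs_of r a)"
    unfolding a_def using adjoint_mult_op[where W = W and q = r, OF W G] by blast+
  have b: "b j \<in> H2 1"
    "\<And>x. cinner (mat_op m 1 (expansions (\<lambda>_. E j)) x) (bwshift (coeffs_of m G)) = cinner x (coeffs_of 1 (b j))"
    if "j < p" for j
    unfolding b_def bshift_H2(2)[OF G, symmetric]
    using adjoint_mult_op[where W = "\<lambda>_. E j" and q = 1, OF E(1)[OF that] E(2)[OF that] bshift_H2(1)[OF G]]
    by blast+
  have full: "full_sum m r p W E G = (\<lambda>z. a z @\<^sub>v Matrix.vec p (\<lambda>j. b j z $ 0))"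
    by (simp add: full_sum_def defect_sum_def a_def b_def)
  \<comment> \<open>The expected coefficients of \<open>full_sum\<close>: the first \<open>r\<close>
    rows from the \<open>W\<close>-block, then one row for each scalar adjoint.\<close>
  define x where "x = (\<Sum>i<r. embed i (component i (coeffs_of r a))) +
    (\<Sum>j<p. embed (r + j) (component 0 (coeffs_of 1 (b j))))"
  have cf_x: "cf x (i, n) = (if i < r then cf (coeffs_of r a) (i, n)
      else if i < r + p then cf (coeffs_of 1 (b (i - r))) (0, n) else 0)" for i n
  proof (cases "r \<le> i")
    case True
    then have "(r + j = i) = (j = i - r)" for j by auto
    then show ?thesis using True by (auto simp: x_def cf_embed)
  qed (auto simp: x_def cf_embed)
  have x: "x \<in> hardy (r + p)" by (simp add: hardy_iff cf_x)
  have full_index: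
    "full_sum m r p W E G z $ i = (if i < r then a z $ i else b (i - r) z $ 0)" if "i < r + p" for z i
    using that H2D(2)[OF a(1)] by (simp add: full)
  then have index: "(\<lambda>z. full_sum m r p W E G z $ i) =
      (if i < r then (\<lambda>z. a z $ i) else (\<lambda>z. b (i - r) z $ 0))" if "i < r + p" for i
    using that by simp
  have hol: "(\<lambda>z. full_sum m r p W E G z $ i) holomorphic_on ball 0 1" if "i < r + p" for i
    using that H2D(4)[OF a(1)] H2D(4)[OF b(1), of "i - r" 0] by (auto simp: index)
  have exp: "(\<lambda>z. full_sum m r p W E G z $ i) has_fps_expansion Abs_fps (\<lambda>n. cf x (i, n))"
    if "i < r + p" for i
  proof (cases "i < r")
    case True
    then show ?thesis using that H2D(5)[OF a(1) True] fps_cf_coeffs_of[OF a(1) True]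
      by (simp add: index cf_x)
  next
    case False
    then have j: "i - r < p" using that by simp
    show ?thesis using that False H2D(5)[OF b(1)[OF j], of 0] fps_cf_coeffs_of[OF b(1)[OF j], of 0]
      by (simp add: index cf_x)
  qed
  have carrier: "full_sum m r p W E G z \<in> carrier_vec (r + p)" for z
    using H2D(2)[OF a(1), of z] by (intro carrier_vecI) (simp add: full)
  have zero: "full_sum m r p W E G z = 0\<^sub>v (r + p)" if z: "z \<notin> ball 0 1" for z
  proof (rule eq_vecI)
    fix i assume "i < dim_vec (0\<^sub>v (r + p) :: complex Matrix.vec)"
    then have i: "i < r + p" by simp
    have "full_sum m r p W E G z $ i = (if i < r then a z $ i else b (i - r) z $ 0)"
      by (rule full_index[OF i])
    also have "\<dots> = 0"
    proof (cases "i < r")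
      case True
      then show ?thesis by (simp add: H2D(3)[OF a(1) z])
    next
      case False
      then have "i - r < p" using i by simp
      from False show ?thesis by (simp add: H2D(3)[OF b(1)[OF \<open>i - r < p\<close>] z])
    qed
    finally show "full_sum m r p W E G z $ i = 0\<^sub>v (r + p) $ i" using i by simp
  qed (use carrier[of z] in simp)
  show "full_sum m r p W E G \<in> H2 (r + p)"
    by (rule H2I(1)[OF carrier zero hol x exp])
  have coeffs: "coeffs_of (r + p) (full_sum m r p W E G) = x"
    by (rule H2I(2)[OF carrier zero hol x exp])
  have "cinner (synthesis m r p W E k) (coeffs_of m G) =
      cinner k (coeffs_of r a) + (\<Sum>j<p. cinner (embed 0 (component (r + j) k)) (coeffs_of 1 (b j)))"
    by (simp add: synthesis_def cinner_add_left cinner_sum_left cinner_fshift a(2) b(2) del: One_nat_def)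
  also have "cinner k (coeffs_of r a) = cinner k (\<Sum>i<r. embed i (component i (coeffs_of r a)))"
    using hardy_eq_sum[OF coeffs_of_hardy[OF a(1)]] by simp
  also have "(\<Sum>j<p. cinner (embed 0 (component (r + j) k)) (coeffs_of 1 (b j))) =
      cinner k (\<Sum>j<p. embed (r + j) (component 0 (coeffs_of 1 (b j))))"
    by (simp add: cinner_sum_right cinner_embed cinner_embed_right)
  finally have "cinner (synthesis m r p W E k) (coeffs_of m G) = cinner k x"
    by (simp add: x_def cinner_add_right)
  then show "cinner (synthesis m r p W E k) (coeffs_of m G) =
      cinner k (coeffs_of (r + p) (full_sum m r p W E G))"
    by (simp only: coeffs)
qed

end

lemma value_0_eq_0_iff:
  assumes "F \<in> H2 m" shows "F 0 = 0\<^sub>v m \<longleftrightarrow> (\<forall>i. cf (coeffs_of m F) (i, 0) = 0)"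
proof -
  have "F 0 = 0\<^sub>v m \<longleftrightarrow> (\<forall>i<m. F 0 $ i = 0)"
  proof
    assume "\<forall>i<m. F 0 $ i = 0"
    then show "F 0 = 0\<^sub>v m" by (intro eq_vecI) (simp_all add: H2D(2)[OF assms])
  qed simp
  then show ?thesis by (simp add: cf_coeffs_of[OF assms] fps_expansion_def)
qed

text \<open>Lets the condition that defines the \<open>W j\<close> be read off the coefficients of
  index 0, as the locale states it.\<close>

lemma mem_range_shift_iff:
  assumes "F \<in> H2 m" shows "F \<in> shift ` H2 m \<longleftrightarrow> (\<forall>i. cf (coeffs_of m F) (i, 0) = 0)"
proof
  assume "F \<in> shift ` H2 m"
  then obtain G where "G \<in> H2 m" "F = shift G" by blast
  then show "\<forall>i. cf (coeffs_of m F) (i, 0) = 0" by (simp add: H2_shift cf_fshift)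
next
  assume *: "\<forall>i. cf (coeffs_of m F) (i, 0) = 0"
  define G where "G = fun_of m (bwshift (coeffs_of m F))"
  have G: "G \<in> H2 m" "coeffs_of m G = bwshift (coeffs_of m F)"
    unfolding G_def by (rule fun_of_H2[OF bwshift_hardy[OF coeffs_of_hardy[OF assms]]])+
  then have "coeffs_of m (shift G) = coeffs_of m F"
    using * by (simp add: H2_shift fshift_bwshift)
  then have "shift G = F" using coeffs_of_inject[OF H2_shift(1)[OF G(1)] assms] by blast
  then show "F \<in> shift ` H2 m" using G(1) by blast
qed

lemma lincomb_mem:
  assumes "H2_subspace m N" "\<And>j. j < n \<Longrightarrow> B j \<in> N"
  shows "lincomb m n c B \<in> N"
proof -
  have N: "N \<subseteq> H2 m" "(\<lambda>z. 0\<^sub>v m) \<in> N"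
    "\<And>F G. F \<in> N \<Longrightarrow> G \<in> N \<Longrightarrow> (\<lambda>z. F z + G z) \<in> N" "\<And>F c. F \<in> N \<Longrightarrow> (\<lambda>z. c \<cdot>\<^sub>v F z) \<in> N"
    using assms(1) by (auto simp: H2_subspace_def)
  show ?thesis using assms(2)
  proof (induction n)
    case 0
    show ?case using N(2) by (simp only: lincomb_0)
  next
    case (Suc n)
    have B: "B n \<in> N" "lincomb m n c B \<in> N" using Suc by simp_all
    have "B n \<in> H2 m" using B(1) N(1) by blast
    then show ?case using N(3)[OF B(2) N(4)[OF B(1)]] by (simp only: lincomb_Suc)
  qed
qed

section \<open>The representation theorem\<close>

text \<open>For \<open>r = 0\<close> the first block is a vector of length 0. This reduces the case
  of functions vanishing at 0 to the general one.\<close>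

lemma full_sum_0:
  assumes "G \<in> H2 m" shows "full_sum m 0 p W E G = defect_sum m p E G"
proof -
  have "adjoint_op 0 (mult_op (cols_fun m 0 W)) G \<in> H2 0"
    by (rule adjoint_mult_op(1)[OF _ _ assms]) simp_all
  then show ?thesis
    by (intro ext eq_vecI) (simp_all add: full_sum_def H2D(2))
qed

theorem theorem4p1:
  fixes m p r :: nat
    and M N :: "vfun set"
    and W E :: "nat \<Rightarrow> vfun"
  assumes "m \<ge> 1" and "p \<ge> 1"
    and "H2_closed_subspace m M"
    and "orthonormal_basis m (M \<ominus>\<^sub>H (M \<inter> shift ` H2 m)) r W"
    and "\<forall>j<r. bounded_on_disc (W j)"
    and "H2_subspace m N" and "H2_orthogonal N M"
    and "orthonormal_basis m N p E"
    and "\<forall>j<p. bounded_on_disc (E j)"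
  shows
    "(defect_space m p M N \<longrightarrow>
        ((\<exists>F\<in>M. F 0 \<noteq> 0\<^sub>v m) \<longrightarrow>
          (\<exists>K. shift_invariant_subspace (r + p) K \<and>
               H2 m \<ominus>\<^sub>H M = {G \<in> H2 m. full_sum m r p W E G \<in> K})) \<and>
        ((\<forall>F\<in>M. F 0 = 0\<^sub>v m) \<longrightarrow>
          (\<exists>K. shift_invariant_subspace p K \<and>
               H2 m \<ominus>\<^sub>H M = {G \<in> H2 m. defect_sum m p E G \<in> K}))) \<and>
     (((\<exists>F\<in>M. F 0 \<noteq> 0\<^sub>v m) \<and>
          (\<exists>K. shift_invariant_subspace (r + p) K \<and>
               H2 m \<ominus>\<^sub>H M = {G \<in> H2 m. full_sum m r p W E G \<in> K}) \<or>
       (\<forall>F\<in>M. F 0 = 0\<^sub>v m) \<and>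
          (\<exists>K. shift_invariant_subspace p K \<and>
               H2 m \<ominus>\<^sub>H M = {G \<in> H2 m. defect_sum m p E G \<in> K})) \<longrightarrow>
      nearly_bshift_invariant m p M)"
proof -
  let ?c = "coeffs_of m"
  note M = coeffs_of_closed_subspace[OF assms(3)]
  have W_M: "W j \<in> M" and W_orth: "\<And>G. G \<in> M \<Longrightarrow> G \<in> shift ` H2 m \<Longrightarrow> H2_inner (W j) G = 0"
    if "j < r" for j
    using assms(4) that by (auto simp: orthonormal_basis_def H2_ominus_def)
  have W_on: "H2_inner (W i) (W j) = (if i = j then 1 else 0)" if "i < r" "j < r" for i j
    using assms(4) that by (simp add: orthonormal_basis_def)
  have W_span: "\<exists>c. F = lincomb m r c W"
    if "F \<in> M" "\<And>G. G \<in> M \<Longrightarrow> G \<in> shift ` H2 m \<Longrightarrow> H2_inner F G = 0" for F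
    using assms(4) that by (simp add: orthonormal_basis_def H2_ominus_def)
  have E_N: "E j \<in> N" if "j < p" for j
    using assms(8) that by (simp add: orthonormal_basis_def)
  have E_on: "H2_inner (E i) (E j) = (if i = j then 1 else 0)" if "i < p" "j < p" for i j
    using assms(8) that by (simp add: orthonormal_basis_def)
  have E_span: "\<exists>c. F = lincomb m p c E" if "F \<in> N" for F
    using assms(8) that by (simp add: orthonormal_basis_def)
  have E_M: "H2_inner (E j) F = 0" if "j < p" "F \<in> M" for j F
    using assms(7) E_N[OF that(1)] that(2) by (simp add: H2_orthogonal_def)
  have M_H2: "F \<in> H2 m" if "F \<in> M" for F using M(1) that by blast
  have N_H2: "F \<in> H2 m" if "F \<in> N" for F using assms(6) that by (auto simp: H2_subspace_def)
  have W_H2: "W j \<in> H2 m" if "j < r" for j by (rule M_H2[OF W_M[OF that]])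
  have E_H2: "E j \<in> H2 m" if "j < p" for j by (rule N_H2[OF E_N[OF that]])
  have W_b: "bounded_on_disc (W j)" if "j < r" for j using assms(5) that by simp
  have E_b: "bounded_on_disc (E j)" if "j < p" for j using assms(9) that by simp
  define S where "S = synthesis m r p W E"
  \<comment> \<open>The adjoint is given on functions, so coefficient families pass through
    \<open>fun_of\<close> first.\<close>
  define S' where "S' g = coeffs_of (r + p) (full_sum m r p W E (fun_of m g))" for g
  have full_sum_H2: "full_sum m r p W E G \<in> H2 (r + p)" if "G \<in> H2 m" for G
    by (rule full_sum_adjoint(1)[OF W_H2 W_b E_H2 E_b that])
  have S'_coeffs: "S' (?c G) = coeffs_of (r + p) (full_sum m r p W E G)" if "G \<in> H2 m" for G
    by (simp add: S'_def fun_of_coeffs_of[OF that])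

  interpret defect_setting m r p "?c ` M" "\<lambda>j. ?c (W j)" "\<lambda>j. ?c (E j)" S S'
  proof
    show "closed (?c ` M)" "csubspace (?c ` M)" "?c ` M \<subseteq> hardy m" by (rule M)+
    show "?c (W j) \<in> ?c ` M" if "j < r" for j using W_M[OF that] by blast
    show "cinner (?c (W i)) (?c (W j)) = (if i = j then 1 else 0)" if "i < r" "j < r" for i j
      using W_on[OF that] H2_inner_eq_cinner[OF W_H2[OF that(1)] W_H2[OF that(2)]] by simp
    show "cinner (?c (W j)) x = 0" if j: "j < r" and x: "x \<in> ?c ` M" "\<And>i. cf x (i, 0) = 0" for j x
    proof -
      obtain F where F: "F \<in> M" "x = ?c F" using x(1) by blast
      then have "F \<in> shift ` H2 m" using x(2) mem_range_shift_iff[OF M_H2[OF F(1)]] by simp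
      then show ?thesis
        using W_orth[OF j F(1)] H2_inner_eq_cinner[OF W_H2[OF j] M_H2[OF F(1)]] F(2) by simp
    qed
    show "\<exists>c. x = (\<Sum>j<r. c j *\<^sub>C ?c (W j))"
      if x: "x \<in> ?c ` M" "\<And>y. y \<in> ?c ` M \<Longrightarrow> (\<And>i. cf y (i, 0) = 0) \<Longrightarrow> cinner x y = 0" for x
    proof -
      obtain F where F: "F \<in> M" "x = ?c F" using x(1) by blast
      have "H2_inner F G = 0" if "G \<in> M" "G \<in> shift ` H2 m" for G
        using x(2)[of "?c G"] that mem_range_shift_iff[OF M_H2[OF that(1)]]
          H2_inner_eq_cinner[OF M_H2[OF F(1)] M_H2[OF that(1)]] F(2) by simp
      then obtain c where "F = lincomb m r c W" using W_span[OF F(1)] by blast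
      then have "x = (\<Sum>j<r. c j *\<^sub>C ?c (W j))" using F(2) H2_lincomb(2)[OF W_H2] by simp
      then show ?thesis by blast
    qed
    show "?c (E j) \<in> hardy m" if "j < p" for j by (rule coeffs_of_hardy[OF E_H2[OF that]])
    show "cinner (?c (E i)) (?c (E j)) = (if i = j then 1 else 0)" if "i < p" "j < p" for i j
      using E_on[OF that] H2_inner_eq_cinner[OF E_H2[OF that(1)] E_H2[OF that(2)]] by simp
    show "cinner (?c (E j)) x = 0" if j: "j < p" and x: "x \<in> ?c ` M" for j x
    proof -
      obtain F where F: "F \<in> M" "x = ?c F" using x by blast
      then show ?thesis
        using E_M[OF j F(1)] H2_inner_eq_cinner[OF E_H2[OF j] M_H2[OF F(1)]] by simp
    qed
    show "S k \<in> hardy m" for k unfolding S_def by (rule synthesis_hardy[OF W_H2 W_b E_H2 E_b])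
    show "S' g \<in> hardy (r + p)" if "g \<in> hardy m" for g
      unfolding S'_def by (rule coeffs_of_hardy[OF full_sum_H2[OF fun_of_H2(1)[OF that]]])
    show "cinner (S k) g = cinner k (S' g)" if "g \<in> hardy m" for k g
    proof -
      have "cinner (S k) (?c (fun_of m g)) = cinner k (S' g)" unfolding S_def S'_def
        by (rule full_sum_adjoint(2)[OF W_H2 W_b E_H2 E_b fun_of_H2(1)[OF that]])
      then show ?thesis by (simp add: fun_of_H2(2)[OF that])
    qed
    show "S k = (\<Sum>j<r. cf k (j, 0) *\<^sub>C ?c (W j)) +
        fshift (S (bwshift k) + (\<Sum>j<p. cf k (r + j, 0) *\<^sub>C ?c (E j)))" for k
      unfolding S_def by (rule synthesis_rec[OF W_H2 W_b E_H2 E_b])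
  qed

  have ominus: "G \<in> H2 m \<ominus>\<^sub>H M \<longleftrightarrow> (\<forall>x\<in>?c ` M. cinner (?c G) x = 0)" if "G \<in> H2 m" for G
    using that by (simp add: H2_ominus_def H2_inner_eq_cinner[OF that M_H2])

  \<comment> \<open>Both cases of the direct part come from this; in the second one \<open>r\<close>
    is 0.\<close>
  have forward: "\<exists>K. shift_invariant_subspace (r + p) K \<and>
      H2 m \<ominus>\<^sub>H M = {G \<in> H2 m. full_sum m r p W E G \<in> K}" if "defect_space m p M N"
  proof -
    have "\<exists>a\<in>?c ` M. \<exists>c. bwshift x = a + (\<Sum>j<p. c j *\<^sub>C ?c (E j))"
      if x: "x \<in> ?c ` M" "\<And>i. cf x (i, 0) = 0" for x
    proof -
      obtain F where F: "F \<in> M" "x = ?c F" using x(1) by blast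
      then have "F 0 = 0\<^sub>v m" using x(2) value_0_eq_0_iff[OF M_H2[OF F(1)]] by simp
      then have "bshift m F \<in> M \<oplus>\<^sub>H N"
        using \<open>defect_space m p M N\<close> F(1) by (simp add: defect_space_def)
      then obtain A B where AB: "A \<in> M" "B \<in> N" "bshift m F = (\<lambda>z. A z + B z)"
        by (auto simp: H2_plus_def)
      obtain c where c: "B = lincomb m p c E" using E_span[OF AB(2)] by blast
      have "bwshift x = ?c (bshift m F)" using bshift_H2(2)[OF M_H2[OF F(1)]] F(2) by simp
      also have "\<dots> = ?c A + ?c B"
        unfolding AB(3) by (rule H2_add(2)[OF M_H2[OF AB(1)] N_H2[OF AB(2)]])
      also have "?c B = (\<Sum>j<p. c j *\<^sub>C ?c (E j))"
        unfolding c by (rule H2_lincomb(2)[OF E_H2])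
      finally show ?thesis using AB(1) by blast
    qed
    then obtain K where K: "closed K" "csubspace K" "K \<subseteq> hardy (r + p)" "fshift ` K \<subseteq> K"
      "\<And>g. g \<in> hardy m \<Longrightarrow> (\<forall>x\<in>?c ` M. cinner g x = 0) \<longleftrightarrow> S' g \<in> K"
      using representation by blast
    define K' where "K' = {F \<in> H2 (r + p). coeffs_of (r + p) F \<in> K}"
    have "shift_invariant_subspace (r + p) K'"
      unfolding shift_invariant_subspace_def K'_def
      using H2_closed_subspaceI[OF K(1,2)] K(4) by (auto simp: H2_shift)
    moreover have "G \<in> H2 m \<ominus>\<^sub>H M \<longleftrightarrow> full_sum m r p W E G \<in> K'" if "G \<in> H2 m" for G
      unfolding ominus[OF that] K(5)[OF coeffs_of_hardy[OF that]] S'_coeffs[OF that]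
      using full_sum_H2[OF that] by (simp add: K'_def)
    then have "H2 m \<ominus>\<^sub>H M = {G \<in> H2 m. full_sum m r p W E G \<in> K'}"
      by (auto simp: H2_ominus_def)
    ultimately show ?thesis by blast
  qed

  have converse: "nearly_bshift_invariant m p M"
    if K: "shift_invariant_subspace (r + p) K"
      "H2 m \<ominus>\<^sub>H M = {G \<in> H2 m. full_sum m r p W E G \<in> K}" for K
  proof -
    let ?d = "coeffs_of (r + p)"
    have K_closed: "H2_closed_subspace (r + p) K" and K_shift: "\<And>F. F \<in> K \<Longrightarrow> shift F \<in> K"
      using K(1) by (auto simp: shift_invariant_subspace_def)
    note cK = coeffs_of_closed_subspace[OF K_closed]
    have "fshift ` (?d ` K) \<subseteq> ?d ` K"
    proof clarify
      fix F assume "F \<in> K"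
      then have "fshift (?d F) = ?d (shift F)" using cK(1) H2_shift(2) by (metis subsetD)
      then show "fshift (?d F) \<in> ?d ` K" using K_shift[OF \<open>F \<in> K\<close>] by simp
    qed
    moreover have "(\<forall>x\<in>?c ` M. cinner g x = 0) \<longleftrightarrow> S' g \<in> ?d ` K" if g: "g \<in> hardy m" for g
    proof -
      define G where "G = fun_of m g"
      have G: "G \<in> H2 m" "?c G = g" unfolding G_def by (rule fun_of_H2[OF g])+
      have "(\<forall>x\<in>?c ` M. cinner g x = 0) \<longleftrightarrow> full_sum m r p W E G \<in> K"
        using ominus[OF G(1)] G K(2) by blast
      \<comment> \<open>Membership in the image reflects membership in \<open>K\<close> because
        \<open>coeffs_of\<close> is injective on \<open>H2 (r + p)\<close>.\<close>
      also have "\<dots> \<longleftrightarrow> S' g \<in> ?d ` K"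
      proof
        assume "S' g \<in> ?d ` K"
        then obtain F where F: "F \<in> K" "?d (full_sum m r p W E G) = ?d F"
          using S'_coeffs[OF G(1)] G(2) by auto
        then have "F \<in> H2 (r + p)" using cK(1) by blast
        then show "full_sum m r p W E G \<in> K"
          using F coeffs_of_inject[OF full_sum_H2[OF G(1)]] by blast
      qed (use S'_coeffs[OF G(1)] G(2) in auto)
      finally show ?thesis .
    qed
    ultimately have dec: "\<exists>a\<in>?c ` M. \<exists>c. bwshift x = a + (\<Sum>j<p. c j *\<^sub>C ?c (E j))"
      if "x \<in> ?c ` M" "\<And>i. cf x (i, 0) = 0" for x
      using that by (intro bwshift_decomposition[OF cK(2-4)])
    have "bshift m F \<in> M \<oplus>\<^sub>H N" if F: "F \<in> M" "F 0 = 0\<^sub>v m" for F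
    proof -
      have "\<exists>a\<in>?c ` M. \<exists>c. bwshift (?c F) = a + (\<Sum>j<p. c j *\<^sub>C ?c (E j))"
        using F value_0_eq_0_iff[OF M_H2[OF F(1)]] by (intro dec) simp_all
      then obtain A c where A: "A \<in> M" "bwshift (?c F) = ?c A + (\<Sum>j<p. c j *\<^sub>C ?c (E j))" by blast
      define B where "B = lincomb m p c E"
      have B: "B \<in> N" unfolding B_def by (rule lincomb_mem[OF assms(6) E_N])
      have coeffs_B: "?c B = (\<Sum>j<p. c j *\<^sub>C ?c (E j))"
        unfolding B_def by (rule H2_lincomb(2)[OF E_H2])
      have "?c (bshift m F) = ?c A + ?c B"
        by (simp add: bshift_H2(2)[OF M_H2[OF F(1)]] A(2) coeffs_B)
      also have "\<dots> = ?c (\<lambda>z. A z + B z)"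
        by (rule H2_add(2)[OF M_H2[OF A(1)] N_H2[OF B], symmetric])
      finally have "bshift m F = (\<lambda>z. A z + B z)"
        using coeffs_of_inject[OF bshift_H2(1)[OF M_H2[OF F(1)]] H2_add(1)[OF M_H2[OF A(1)] N_H2[OF B]]]
        by blast
      then show ?thesis using A(1) B unfolding H2_plus_def by blast
    qed
    \<comment> \<open>Orthonormality gives linear independence, so the dimension of \<open>N\<close>
      is exactly \<open>p\<close>.\<close>
    moreover have "c j = 0" if "lincomb m p c E = (\<lambda>z. 0\<^sub>v m)" "j < p" for c j
    proof -
      have "?c (lincomb m p c E) = (\<Sum>j<p. c j *\<^sub>C ?c (E j))"
        by (rule H2_lincomb(2)[OF E_H2])
      then have "(\<Sum>j<p. c j *\<^sub>C ?c (E j)) = 0" using that(1) H2_zero(2)[of m] by simp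
      then show ?thesis using cinner_sum_e_e[OF that(2), of c] by simp
    qed
    then have "H2_dim m N p"
      unfolding H2_dim_def using E_N E_span by blast
    ultimately have "defect_space m p M N"
      unfolding defect_space_def using assms(6,7) by blast
    then show ?thesis unfolding nearly_bshift_invariant_def using assms(3) by blast
  qed

  \<comment> \<open>Otherwise \<open>W 0\<close> would lie in the very subspace to which it is
    orthogonal, hence have norm 0 instead of 1.\<close>
  have r_eq_0: "r = 0" if "\<forall>F\<in>M. F 0 = 0\<^sub>v m"
  proof (rule ccontr)
    assume "r \<noteq> 0"
    then have r: "0 < r" by simp
    have "W 0 \<in> shift ` H2 m"
      using that W_M[OF r] value_0_eq_0_iff[OF W_H2[OF r]] mem_range_shift_iff[OF W_H2[OF r]] by blast
    then have "H2_inner (W 0) (W 0) = 0" using W_orth[OF r W_M[OF r]] by blast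
    then show False using W_on[OF r r] by simp
  qed
  have defect: "{G \<in> H2 m. full_sum m r p W E G \<in> K} = {G \<in> H2 m. defect_sum m p E G \<in> K}"
    if "\<forall>F\<in>M. F 0 = 0\<^sub>v m" for K
    using full_sum_0 r_eq_0[OF that] by auto
  show ?thesis
  proof (intro conjI impI)
    show "\<exists>K. shift_invariant_subspace (r + p) K \<and>
        H2 m \<ominus>\<^sub>H M = {G \<in> H2 m. full_sum m r p W E G \<in> K}" if "defect_space m p M N"
      by (rule forward[OF that])
    show "\<exists>K. shift_invariant_subspace p K \<and> H2 m \<ominus>\<^sub>H M = {G \<in> H2 m. defect_sum m p E G \<in> K}"
      if "defect_space m p M N" "\<forall>F\<in>M. F 0 = 0\<^sub>v m"
      using forward[OF that(1)] unfolding defect[OF that(2)] by (simp add: r_eq_0[OF that(2)])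
    assume rep: "(\<exists>F\<in>M. F 0 \<noteq> 0\<^sub>v m) \<and>
          (\<exists>K. shift_invariant_subspace (r + p) K \<and>
               H2 m \<ominus>\<^sub>H M = {G \<in> H2 m. full_sum m r p W E G \<in> K}) \<or>
       (\<forall>F\<in>M. F 0 = 0\<^sub>v m) \<and>
          (\<exists>K. shift_invariant_subspace p K \<and>
               H2 m \<ominus>\<^sub>H M = {G \<in> H2 m. defect_sum m p E G \<in> K})"
    show "nearly_bshift_invariant m p M"
    proof (cases "\<forall>F\<in>M. F 0 = 0\<^sub>v m")
      case True
      then obtain K where "shift_invariant_subspace p K"
        "H2 m \<ominus>\<^sub>H M = {G \<in> H2 m. defect_sum m p E G \<in> K}" using rep by blast
      then show ?thesis
        using converse[of K] r_eq_0[OF True] defect[OF True, of K] by simp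
    next
      case False
      then show ?thesis using rep converse by blast
    qed
  qed
qed

end
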